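(* Let $\mathcal{H}$ be a complex Hilbert space and let $T\in\mathcal{B}(\mathcal{H})$ be similar to a contraction. (i) $T$ admits a quasi-isometric lifting $S$ on a space $\mathcal{K}\supset\mathcal{H}$ which is similar to an isometry, such that $S$ has, under a decomposition $\mathcal{K}=\mathcal{L}\oplus\mathcal{M}$ with $\{0\}\ne\mathcal{L}\subset\mathcal{K}\ominus\mathcal{H}$, a block matrix of the form $$S=\begin{pmatrix}V&G\\0&Q\end{pmatrix},$$ where $V=S|_{\mathcal{L}}$ is an isometry with $\mathcal{N}(V^* )=\mathcal{R}(G)$, and $Q$ is a quasi-isometric lifting for $T$ on the space $\mathcal{M}\supset\mathcal{H}$, with $\overline{\mathcal{R}(Q)}=\mathcal{N}(G)$ and $\mathcal{N}(Q^* )\subset\mathcal{N}(S^* )$. (ii) Let $S$ be any left invertible quasi-isometric lifting for $T$ on a space $\mathcal{K}=\mathcal{L}\oplus\mathcal{M}$ with block matrix $S=\begin{pmatrix}V&G\\0&Q\end{pmatrix}$, where $S\mathcal{L}\subset\mathcal{L}\subset\mathcal{K}\ominus\mathcal{H}$ and $V=S|_{\mathcal{L}}$ is an isometry with $\mathcal{N}(V^* )=\overline{\mathcal{R}(G)}$. Then the lifting $Q=P_{\mathcal{M}}S|_{\mathcal{M}}$ for $T$ on $\mathcal{M}\supset\mathcal{H}$ is quasi-isometric if and only if $\mathcal{R}(Q)\subset\mathcal{N}(G)$. Additionally, the two conditions $$\mathcal{R}(G^* )\subset\mathcal{N}(Q^* )=\mathcal{N}(S^* )\qquad\text{and}\qquad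 S\mathcal{R}(Q)\subset\mathcal{R}(Q)\subset\mathcal{R}(S)$$ are equivalent to each other.
   Context: $\mathcal{B}(\mathcal{H})$ is the algebra of bounded operators on $\mathcal{H}$; $\mathcal{R}(X)$, $\mathcal{N}(X)$ are the range and kernel of $X$. $T$ is similar to a contraction if there is an invertible positive $A\in\mathcal{B}(\mathcal{H})$ with $T^*AT\le A$. When $\mathcal{K}\supset\mathcal{H}$ is a Hilbert space containing $\mathcal{H}$ as a closed subspace and $P_{\mathcal{K},\mathcal{H}}:\mathcal{K}\to\mathcal{H}$ is the orthogonal projection, $S\in\mathcal{B}(\mathcal{K})$ is a lifting for $T$ if $P_{\mathcal{K},\mathcal{H}}S=TP_{\mathcal{K},\mathcal{H}}$. $S$ is a quasi-isometry (quasi-isometric) if $S^{*2}S^2=S^*S$. $S$ is left invertible if $S^*S$ is invertible. $\mathcal{L}$ and $\mathcal{M}$ are orthogonal closed subspaces of $\mathcal{K}$, $G:\mathcal{M}\to\mathcal{L}$ and $Q:\mathcal{M}\to\mathcal{M}$ are the entries of the block matrix of $S$, and subspaces of $\mathcal{L}$, $\mathcal{M}$, such as $\mathcal{N}(Q^* )$, are regarded as subspaces of $\mathcal{K}$. *)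

theory Defs
  imports "HOL-Analysis.Analysis"
begin

section \<open>Complex Hilbert spaces\<close>

text \<open>
  The distribution only has real inner product spaces. A complex inner product space is one whose
  underlying real inner product is the real part of a sesquilinear form, linear in the first
  argument. Hence the norm is \<open>sqrt (Re (cinner x x))\<close>, the library's topology is the right one,
  and positive definiteness of \<open>cinner\<close> is inherited from \<open>real_inner\<close>.
\<close>

class complex_inner = real_inner +
  fixes scaleC :: "complex \<Rightarrow> 'a \<Rightarrow> 'a" (infixr \<open>*\<^sub>C\<close> 75)
    and cinner :: "'a \<Rightarrow> 'a \<Rightarrow> complex"
  assumes scaleC_add_right: "c *\<^sub>C (x + y) = c *\<^sub>C x + c *\<^sub>C y"
    and scaleC_add_left: "(c + d) *\<^sub>C x = c *\<^sub>C x + d *\<^sub>C x"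
    and scaleC_scaleC: "c *\<^sub>C (d *\<^sub>C x) = (c * d) *\<^sub>C x"
    and scaleC_of_real: "complex_of_real r *\<^sub>C x = r *\<^sub>R x"
    and cinner_add_left: "cinner (x + y) z = cinner x z + cinner y z"
    and cinner_scaleC_left: "cinner (c *\<^sub>C x) y = c * cinner x y"
    and cinner_commute: "cinner x y = cnj (cinner y x)"
    and Re_cinner: "Re (cinner x y) = inner x y"

class chilbert_space = complex_inner + complete_space

lemma cinner_self: "cinner x x = complex_of_real ((norm x)\<^sup>2)" for x :: "'a::complex_inner"
proof -
  have "Im (cinner x x) = 0"
    using cinner_commute[of x x] by (metis Reals_cnj_iff complex_is_Real_iff)
  moreover have "Re (cinner x x) = (norm x)\<^sup>2"
    by (simp add: Re_cinner power2_norm_eq_inner)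
  ultimately show ?thesis
    by (simp add: complex_eq_iff)
qed

lemma cinner_scaleC_right: "cinner x (c *\<^sub>C y) = cnj c * cinner x y" for x :: "'a::complex_inner"
  by (metis cinner_commute cinner_scaleC_left complex_cnj_mult)

lemma norm_scaleC: "norm (c *\<^sub>C x) = cmod c * norm x" for x :: "'a::complex_inner"
proof -
  have "complex_of_real ((norm (c *\<^sub>C x))\<^sup>2) = (c * cnj c) * cinner x x"
    by (simp only: cinner_self[symmetric] cinner_scaleC_left cinner_scaleC_right ac_simps)
  also have "\<dots> = complex_of_real ((cmod c * norm x)\<^sup>2)"
    by (simp only: cinner_self complex_norm_square[symmetric] power_mult_distrib of_real_mult)
  finally have "(norm (c *\<^sub>C x))\<^sup>2 = (cmod c * norm x)\<^sup>2"
    using of_real_eq_iff by blast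
  then show ?thesis
    by simp
qed

lemma norm_cinner_le: "cmod (cinner x y) \<le> norm x * norm y" for x :: "'a::complex_inner"
proof (cases "cinner x y = 0")
  case False
  define c where "c = cnj (sgn (cinner x y))"
  have c: "cmod c = 1"
    using False by (simp add: c_def norm_sgn)
  have "c * cinner x y = complex_of_real (cmod (cinner x y))"
    using False complex_norm_square[of "cinner x y"]
    by (simp add: c_def sgn_eq field_simps power2_eq_square)
  then have "cmod (cinner x y) = inner (c *\<^sub>C x) y"
    by (metis Re_cinner Re_complex_of_real cinner_scaleC_left)
  also have "\<dots> \<le> norm x * norm y"
    using norm_cauchy_schwarz[of "c *\<^sub>C x" y] by (simp add: norm_scaleC c)
  finally show ?thesis .
qed simp

instantiation complex :: chilbert_space
begin

definition scaleC_complex :: "complex \<Rightarrow> complex \<Rightarrow> complex"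
  where "scaleC_complex c x = c * x"

definition cinner_complex :: "complex \<Rightarrow> complex \<Rightarrow> complex"
  where "cinner_complex x y = x * cnj y"

instance
  by standard
    (auto simp: scaleC_complex_def cinner_complex_def algebra_simps scaleR_conv_of_real
      inner_complex_def)

end

instantiation prod :: (complex_inner, complex_inner) complex_inner
begin

definition scaleC_prod :: "complex \<Rightarrow> 'a \<times> 'b \<Rightarrow> 'a \<times> 'b"
  where "scaleC_prod c x = (c *\<^sub>C fst x, c *\<^sub>C snd x)"

definition cinner_prod :: "'a \<times> 'b \<Rightarrow> 'a \<times> 'b \<Rightarrow> complex"
  where "cinner_prod x y = cinner (fst x) (fst y) + cinner (snd x) (snd y)"

instance
proof
  fix x y :: "'a \<times> 'b"
  show "cinner x y = cnj (cinner y x)"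
    by (simp add: cinner_prod_def cinner_commute[symmetric])
qed (auto simp: scaleC_prod_def cinner_prod_def scaleC_add_right scaleC_add_left scaleC_scaleC
      scaleC_of_real cinner_add_left cinner_scaleC_left Re_cinner inner_prod_def algebra_simps
      scaleR_prod_def)

end

instance prod :: (chilbert_space, chilbert_space) chilbert_space ..


section \<open>The Hilbert space of square-summable sequences\<close>

text \<open>
  HOL cannot quantify existentially over types, so the existence of a Hilbert space containing a
  given space \<open>'h\<close> is stated for the concrete space \<open>('h \<times> complex) ell2\<close>. The summand
  \<open>complex\<close> makes it infinite-dimensional even if \<open>'h\<close> is trivial.
\<close>

typedef (overloaded) 'a ell2 = "{f :: nat \<Rightarrow> 'a::complex_inner. summable (\<lambda>n. (norm (f n))\<^sup>2)}"
  by (rule exI[of _ "\<lambda>_. 0"]) simp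

lemma ell2_summable: "summable (\<lambda>n. (norm (Rep_ell2 x n))\<^sup>2)"
  using Rep_ell2[of x] by simp

lemma ell2_eqI: "(\<And>n. Rep_ell2 x n = Rep_ell2 y n) \<Longrightarrow> x = y"
  by (metis Rep_ell2_inject ext)

lemma square_summable_add:
  fixes f g :: "nat \<Rightarrow> 'a::real_inner"
  assumes "summable (\<lambda>n. (norm (f n))\<^sup>2)" "summable (\<lambda>n. (norm (g n))\<^sup>2)"
  shows "summable (\<lambda>n. (norm (f n + g n))\<^sup>2)"
proof (rule summable_comparison_test')
  show "summable (\<lambda>n. 2 * (norm (f n))\<^sup>2 + 2 * (norm (g n))\<^sup>2)"
    using assms by (intro summable_add summable_mult)
  show "norm ((norm (f n + g n))\<^sup>2) \<le> 2 * (norm (f n))\<^sup>2 + 2 * (norm (g n))\<^sup>2" if "n \<ge> 0" for n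
  proof -
    have "(norm (f n + g n))\<^sup>2 \<le> (norm (f n) + norm (g n))\<^sup>2"
      by (simp add: norm_triangle_ineq power_mono)
    also have "\<dots> \<le> 2 * (norm (f n))\<^sup>2 + 2 * (norm (g n))\<^sup>2"
      using sum_squares_bound[of "norm (f n)" "norm (g n)"] by (simp add: power2_sum)
    finally show ?thesis
      by simp
  qed
qed

lemma square_summable_cinner:
  fixes f g :: "nat \<Rightarrow> 'a::complex_inner"
  assumes "summable (\<lambda>n. (norm (f n))\<^sup>2)" "summable (\<lambda>n. (norm (g n))\<^sup>2)"
  shows "summable (\<lambda>n. cinner (f n) (g n))"
proof (rule summable_comparison_test')
  show "summable (\<lambda>n. (norm (f n))\<^sup>2 + (norm (g n))\<^sup>2)"
    using assms by (rule summable_add)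
  show "norm (cinner (f n) (g n)) \<le> (norm (f n))\<^sup>2 + (norm (g n))\<^sup>2" if "n \<ge> 0" for n
    using norm_cinner_le[of "f n" "g n"] sum_squares_bound[of "norm (f n)" "norm (g n)"]
      mult_nonneg_nonneg[OF norm_ge_zero[of "f n"] norm_ge_zero[of "g n"]]
    by linarith
qed

instantiation ell2 :: (complex_inner) complex_inner
begin

definition zero_ell2 :: "'a ell2"
  where "0 = Abs_ell2 (\<lambda>_. 0)"
definition plus_ell2 :: "'a ell2 \<Rightarrow> 'a ell2 \<Rightarrow> 'a ell2"
  where "x + y = Abs_ell2 (\<lambda>n. Rep_ell2 x n + Rep_ell2 y n)"
definition uminus_ell2 :: "'a ell2 \<Rightarrow> 'a ell2"
  where "- x = Abs_ell2 (\<lambda>n. - Rep_ell2 x n)"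
definition minus_ell2 :: "'a ell2 \<Rightarrow> 'a ell2 \<Rightarrow> 'a ell2"
  where "x - y = Abs_ell2 (\<lambda>n. Rep_ell2 x n - Rep_ell2 y n)"
definition scaleR_ell2 :: "real \<Rightarrow> 'a ell2 \<Rightarrow> 'a ell2"
  where "r *\<^sub>R x = Abs_ell2 (\<lambda>n. r *\<^sub>R Rep_ell2 x n)"
definition scaleC_ell2 :: "complex \<Rightarrow> 'a ell2 \<Rightarrow> 'a ell2"
  where "c *\<^sub>C x = Abs_ell2 (\<lambda>n. c *\<^sub>C Rep_ell2 x n)"
definition cinner_ell2 :: "'a ell2 \<Rightarrow> 'a ell2 \<Rightarrow> complex"
  where "cinner x y = (\<Sum>n. cinner (Rep_ell2 x n) (Rep_ell2 y n))"
definition inner_ell2 :: "'a ell2 \<Rightarrow> 'a ell2 \<Rightarrow> real"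
  where "inner x y = (\<Sum>n. inner (Rep_ell2 x n) (Rep_ell2 y n))"
definition norm_ell2 :: "'a ell2 \<Rightarrow> real"
  where "norm_ell2 x = sqrt (inner x x)"
definition sgn_ell2 :: "'a ell2 \<Rightarrow> 'a ell2"
  where "sgn_ell2 x = inverse (norm x) *\<^sub>R x"
definition dist_ell2 :: "'a ell2 \<Rightarrow> 'a ell2 \<Rightarrow> real"
  where "dist_ell2 x y = norm (x - y)"
definition uniformity_ell2 :: "('a ell2 \<times> 'a ell2) filter"
  where "(uniformity :: ('a ell2 \<times> 'a ell2) filter) = (INF e\<in>{0<..}. principal {(x, y). dist x y < e})"
definition open_ell2 :: "'a ell2 set \<Rightarrow> bool"
  where "open_ell2 U = (\<forall>x\<in>U. eventually (\<lambda>(x', y). x' = x \<longrightarrow> y \<in> U) uniformity)"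

lemma Rep_ell2_zero [simp]: "Rep_ell2 0 n = 0"
  by (simp add: zero_ell2_def Abs_ell2_inverse)

lemma Rep_ell2_add [simp]: "Rep_ell2 (x + y) n = Rep_ell2 x n + Rep_ell2 y n"
  by (simp add: plus_ell2_def Abs_ell2_inverse square_summable_add ell2_summable)

lemma Rep_ell2_uminus [simp]: "Rep_ell2 (- x) n = - Rep_ell2 x n"
  by (simp add: uminus_ell2_def Abs_ell2_inverse ell2_summable)

lemma Rep_ell2_minus [simp]: "Rep_ell2 (x - y) n = Rep_ell2 x n - Rep_ell2 y n"
  using square_summable_add[OF ell2_summable[of x] ell2_summable[of "- y"]]
  by (simp add: minus_ell2_def Abs_ell2_inverse)

lemma Rep_ell2_scaleR [simp]: "Rep_ell2 (r *\<^sub>R x) n = r *\<^sub>R Rep_ell2 x n"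
  by (simp add: scaleR_ell2_def Abs_ell2_inverse ell2_summable power_mult_distrib summable_mult)

lemma Rep_ell2_scaleC [simp]: "Rep_ell2 (c *\<^sub>C x) n = c *\<^sub>C Rep_ell2 x n"
  by (simp add: scaleC_ell2_def Abs_ell2_inverse ell2_summable power_mult_distrib summable_mult
      norm_scaleC)

lemma ell2_summable_cinner: "summable (\<lambda>n. cinner (Rep_ell2 x n) (Rep_ell2 y n))"
  by (intro square_summable_cinner ell2_summable)

lemma ell2_summable_inner: "summable (\<lambda>n. inner (Rep_ell2 x n) (Rep_ell2 y n))"
  using summable_Re[OF ell2_summable_cinner[of x y]] by (simp add: Re_cinner)

instance
proof
  fix x y z :: "'a ell2" and a b r :: real and c d :: complex
  show "x + y + z = x + (y + z)" "x + y = y + x" "0 + x = x" "- x + x = 0" "x - y = x + - y"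
    by (rule ell2_eqI, simp)+
  show "a *\<^sub>R (x + y) = a *\<^sub>R x + a *\<^sub>R y" "(a + b) *\<^sub>R x = a *\<^sub>R x + b *\<^sub>R x"
    "a *\<^sub>R b *\<^sub>R x = (a * b) *\<^sub>R x" "1 *\<^sub>R x = x"
    by (rule ell2_eqI, simp add: scaleR_add_right scaleR_add_left)+
  show "c *\<^sub>C (x + y) = c *\<^sub>C x + c *\<^sub>C y" "(c + d) *\<^sub>C x = c *\<^sub>C x + d *\<^sub>C x"
    "c *\<^sub>C (d *\<^sub>C x) = (c * d) *\<^sub>C x" "complex_of_real r *\<^sub>C x = r *\<^sub>R x"
    by (rule ell2_eqI, simp add: scaleC_add_right scaleC_add_left scaleC_scaleC scaleC_of_real)+
  show "inner x y = inner y x"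
    by (simp add: inner_ell2_def inner_commute)
  show "inner (x + y) z = inner x z + inner y z"
    by (simp add: inner_ell2_def inner_add_left suminf_add ell2_summable_inner)
  show "inner (r *\<^sub>R x) y = r * inner x y"
    by (simp add: inner_ell2_def suminf_mult ell2_summable_inner)
  show "0 \<le> inner x x"
    by (simp add: inner_ell2_def suminf_nonneg ell2_summable_inner)
  have "inner x x = 0 \<longleftrightarrow> (\<forall>n. inner (Rep_ell2 x n) (Rep_ell2 x n) = 0)"
    unfolding inner_ell2_def by (rule suminf_eq_zero_iff) (simp_all add: ell2_summable_inner)
  then show "inner x x = 0 \<longleftrightarrow> x = 0"
    by (auto intro: ell2_eqI)
  show "cinner (x + y) z = cinner x z + cinner y z"
    by (simp add: cinner_ell2_def cinner_add_left suminf_add ell2_summable_cinner)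
  show "cinner (c *\<^sub>C x) y = c * cinner x y"
    by (simp add: cinner_ell2_def cinner_scaleC_left suminf_mult ell2_summable_cinner)
  have "(\<lambda>n. cinner (Rep_ell2 x n) (Rep_ell2 y n)) sums cnj (cinner y x)"
    using sums_cnj[THEN iffD2, OF summable_sums[OF ell2_summable_cinner[of y x]]]
    by (simp add: cinner_ell2_def cinner_commute[symmetric])
  then show "cinner x y = cnj (cinner y x)"
    by (simp add: cinner_ell2_def sums_iff)
  show "Re (cinner x y) = inner x y"
    by (simp add: cinner_ell2_def inner_ell2_def Re_suminf ell2_summable_cinner Re_cinner)
qed (rule sgn_ell2_def dist_ell2_def norm_ell2_def uniformity_ell2_def open_ell2_def)+

end

lemma norm_ell2_sq: "(norm x)\<^sup>2 = (\<Sum>n. (norm (Rep_ell2 x n))\<^sup>2)"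
  by (simp add: power2_norm_eq_inner inner_ell2_def)

lemma norm_Rep_ell2_le: "norm (Rep_ell2 x n) \<le> norm x"
proof -
  have "(\<Sum>k\<in>{n}. (norm (Rep_ell2 x k))\<^sup>2) \<le> (\<Sum>k. (norm (Rep_ell2 x k))\<^sup>2)"
    by (rule sum_le_suminf) (simp_all add: ell2_summable)
  then have "(norm (Rep_ell2 x n))\<^sup>2 \<le> (norm x)\<^sup>2"
    by (simp add: norm_ell2_sq)
  then show ?thesis
    by (rule power2_le_imp_le) simp
qed

instance ell2 :: (chilbert_space) chilbert_space
proof
  fix X :: "nat \<Rightarrow> 'a ell2"
  assume X: "Cauchy X"
  have "Cauchy (\<lambda>k. Rep_ell2 (X k) n)" for n
  proof (rule metric_CauchyI)
    fix e :: real
    assume "e > 0"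
    then obtain M where M: "\<And>k m. k \<ge> M \<Longrightarrow> m \<ge> M \<Longrightarrow> dist (X k) (X m) < e"
      using metric_CauchyD[OF X] by metis
    have "dist (Rep_ell2 (X k) n) (Rep_ell2 (X m) n) < e" if "k \<ge> M" "m \<ge> M" for k m
      using norm_Rep_ell2_le[of "X k - X m" n] M[OF that] by (simp add: dist_norm)
    then show "\<exists>M. \<forall>k\<ge>M. \<forall>m\<ge>M. dist (Rep_ell2 (X k) n) (Rep_ell2 (X m) n) < e"
      by blast
  qed
  then have "\<exists>l. (\<lambda>k. Rep_ell2 (X k) n) \<longlonglongrightarrow> l" for n
    using Cauchy_convergent convergent_def by blast
  then obtain f where f: "\<And>n. (\<lambda>k. Rep_ell2 (X k) n) \<longlonglongrightarrow> f n"
    by metis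
  have tail: "summable (\<lambda>n. (norm (Rep_ell2 (X k) n - f n))\<^sup>2) \<and>
      (\<Sum>n. (norm (Rep_ell2 (X k) n - f n))\<^sup>2) \<le> e\<^sup>2"
    if M: "\<And>k m. k \<ge> M \<Longrightarrow> m \<ge> M \<Longrightarrow> dist (X k) (X m) < e" and k: "k \<ge> M" for M k e
  proof -
    have part: "(\<Sum>n<N. (norm (Rep_ell2 (X k) n - f n))\<^sup>2) \<le> e\<^sup>2" for N
    proof (rule LIMSEQ_le_const2)
      show "(\<lambda>m. \<Sum>n<N. (norm (Rep_ell2 (X k) n - Rep_ell2 (X m) n))\<^sup>2)
          \<longlonglongrightarrow> (\<Sum>n<N. (norm (Rep_ell2 (X k) n - f n))\<^sup>2)"
        by (intro tendsto_intros f)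
      have "(\<Sum>n<N. (norm (Rep_ell2 (X k) n - Rep_ell2 (X m) n))\<^sup>2) \<le> e\<^sup>2" if "m \<ge> M" for m
      proof -
        have "(\<Sum>n<N. (norm (Rep_ell2 (X k - X m) n))\<^sup>2) \<le> (norm (X k - X m))\<^sup>2"
          unfolding norm_ell2_sq by (rule sum_le_suminf[OF ell2_summable]) simp_all
        also have "\<dots> \<le> e\<^sup>2"
          using M[OF k that] by (intro power_mono) (simp_all add: dist_norm)
        finally show ?thesis
          by simp
      qed
      then show "\<exists>M. \<forall>m\<ge>M. (\<Sum>n<N. (norm (Rep_ell2 (X k) n - Rep_ell2 (X m) n))\<^sup>2) \<le> e\<^sup>2"
        by blast
    qed
    have "summable (\<lambda>n. (norm (Rep_ell2 (X k) n - f n))\<^sup>2)"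
      by (rule summableI_nonneg_bounded[OF _ part]) simp
    then show ?thesis
      using suminf_le_const[OF _ part] by blast
  qed
  obtain M1 where M1: "\<And>k m. k \<ge> M1 \<Longrightarrow> m \<ge> M1 \<Longrightarrow> dist (X k) (X m) < 1"
    using metric_CauchyD[OF X, of 1] by auto
  have "summable (\<lambda>n. (norm (Rep_ell2 (X M1) n - f n))\<^sup>2)"
    by (rule conjunct1[OF tail[where M = M1 and k = M1 and e = 1]]) (auto intro: M1)
  from square_summable_add[OF this ell2_summable[of "- X M1"]]
  have "summable (\<lambda>n. (norm (f n))\<^sup>2)"
    by simp
  then have Rep: "Rep_ell2 (Abs_ell2 f) = f"
    by (simp add: Abs_ell2_inverse)
  have "X \<longlonglongrightarrow> Abs_ell2 f"
  proof (rule metric_LIMSEQ_I)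
    fix r :: real
    assume r: "r > 0"
    then obtain M where M: "\<And>k m. k \<ge> M \<Longrightarrow> m \<ge> M \<Longrightarrow> dist (X k) (X m) < r / 2"
      using metric_CauchyD[OF X, of "r / 2"] half_gt_zero[OF r] by metis
    have "dist (X k) (Abs_ell2 f) < r" if "k \<ge> M" for k
    proof -
      have "(\<Sum>n. (norm (Rep_ell2 (X k) n - f n))\<^sup>2) \<le> (r / 2)\<^sup>2"
        by (rule conjunct2[OF tail[where M = M and k = k and e = "r / 2"]])
          (rule M that | assumption)+
      then have "(norm (X k - Abs_ell2 f))\<^sup>2 \<le> (r / 2)\<^sup>2"
        by (simp add: norm_ell2_sq Rep)
      then have "norm (X k - Abs_ell2 f) \<le> r / 2"
        by (rule power2_le_imp_le) (use r in simp)
      then show ?thesis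
        using r by (simp add: dist_norm)
    qed
    then show "\<exists>M. \<forall>k\<ge>M. dist (X k) (Abs_ell2 f) < r"
      by blast
  qed
  then show "convergent X"
    by (rule convergentI)
qed


section \<open>Operators between subspaces\<close>

text \<open>
  An operator from a subspace \<open>X\<close> to a subspace \<open>Y\<close> is a function on the ambient types whose
  values outside \<open>X\<close> are irrelevant; every notion below only looks at arguments in \<open>X\<close>.
\<close>

definition closed_subspace :: "'a::chilbert_space set \<Rightarrow> bool"
  where "closed_subspace X \<longleftrightarrow>
    0 \<in> X \<and> (\<forall>x\<in>X. \<forall>y\<in>X. x + y \<in> X) \<and> (\<forall>c. \<forall>x\<in>X. c *\<^sub>C x \<in> X) \<and> closed X"

definition orth_decomp :: "'a::chilbert_space set \<Rightarrow> 'a set \<Rightarrow> bool"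
  where "orth_decomp L M \<longleftrightarrow> closed_subspace L \<and> closed_subspace M \<and>
    (\<forall>l\<in>L. \<forall>m\<in>M. cinner l m = 0) \<and> (\<forall>x. \<exists>l\<in>L. \<exists>m\<in>M. x = l + m)"

definition proj :: "'a::chilbert_space set \<Rightarrow> 'a \<Rightarrow> 'a"
  where "proj X x = (THE y. y \<in> X \<and> (\<forall>z\<in>X. cinner (x - y) z = 0))"

definition bounded_op ::
  "'a::chilbert_space set \<Rightarrow> 'b::chilbert_space set \<Rightarrow> ('a \<Rightarrow> 'b) \<Rightarrow> bool"
  where "bounded_op X Y A \<longleftrightarrow> (\<forall>x\<in>X. A x \<in> Y) \<and>
    (\<forall>x\<in>X. \<forall>y\<in>X. A (x + y) = A x + A y) \<and> (\<forall>c. \<forall>x\<in>X. A (c *\<^sub>C x) = c *\<^sub>C A x) \<and>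
    (\<exists>B. \<forall>x\<in>X. norm (A x) \<le> B * norm x)"

definition ker :: "'a::chilbert_space set \<Rightarrow> ('a \<Rightarrow> 'b::chilbert_space) \<Rightarrow> 'a set"
  where "ker X A = {x \<in> X. A x = 0}"

text \<open>
  \<open>adj X A\<close> is the adjoint of an operator \<open>A\<close> defined on \<open>X\<close>. It has values in \<open>X\<close> and is meant to
  be applied to vectors of the codomain of \<open>A\<close>.
\<close>

definition adj :: "'a::chilbert_space set \<Rightarrow> ('a \<Rightarrow> 'b::chilbert_space) \<Rightarrow> 'b \<Rightarrow> 'a"
  where "adj X A y = (THE z. z \<in> X \<and> (\<forall>x\<in>X. cinner (A x) y = cinner x z))"

definition invertible_op :: "'a::chilbert_space set \<Rightarrow> ('a \<Rightarrow> 'a) \<Rightarrow> bool"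
  where "invertible_op X A \<longleftrightarrow> bounded_op X X A \<and>
    (\<exists>B. bounded_op X X B \<and> (\<forall>x\<in>X. B (A x) = x \<and> A (B x) = x))"

definition isometry_op ::
  "'a::chilbert_space set \<Rightarrow> 'b::chilbert_space set \<Rightarrow> ('a \<Rightarrow> 'b) \<Rightarrow> bool"
  where "isometry_op X Y A \<longleftrightarrow> bounded_op X Y A \<and> (\<forall>x\<in>X. norm (A x) = norm x)"

definition quasi_isometry :: "'a::chilbert_space set \<Rightarrow> ('a \<Rightarrow> 'a) \<Rightarrow> bool"
  where "quasi_isometry X S \<longleftrightarrow> bounded_op X X S \<and>
    (\<forall>x\<in>X. adj X S (adj X S (S (S x))) = adj X S (S x))"

definition left_invertible :: "'a::chilbert_space set \<Rightarrow> ('a \<Rightarrow> 'a) \<Rightarrow> bool"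
  where "left_invertible X S \<longleftrightarrow> bounded_op X X S \<and> invertible_op X (adj X S \<circ> S)"

definition op_le :: "('a::chilbert_space \<Rightarrow> 'a) \<Rightarrow> ('a \<Rightarrow> 'a) \<Rightarrow> bool"
  where "op_le A B \<longleftrightarrow> (\<forall>x. cinner (B x - A x) x \<in> \<real>\<^sub>\<ge>\<^sub>0)"

definition similar_to_contraction :: "('a::chilbert_space \<Rightarrow> 'a) \<Rightarrow> bool"
  where "similar_to_contraction T \<longleftrightarrow> bounded_op UNIV UNIV T \<and>
    (\<exists>A. invertible_op UNIV A \<and> op_le (\<lambda>_. 0) A \<and> op_le (adj UNIV T \<circ> A \<circ> T) A)"

text \<open>Similarity in the usual sense: \<open>X S X\<^sup>-\<^sup>1\<close> is an isometry \<open>W\<close> for some invertible \<open>X\<close>.\<close>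

definition similar_to_isometry :: "('a::chilbert_space \<Rightarrow> 'a) \<Rightarrow> bool"
  where "similar_to_isometry S \<longleftrightarrow> bounded_op UNIV UNIV S \<and>
    (\<exists>X W. invertible_op UNIV X \<and> isometry_op UNIV UNIV W \<and> X \<circ> S = W \<circ> X)"

text \<open>
  The block matrix of \<open>S\<close> with respect to \<open>L \<oplus> M\<close> is \<open>V, G\<close> over \<open>0, Q\<close>. In particular
  \<open>S\<close> maps \<open>L\<close> into itself and agrees there with \<open>V\<close>, and \<open>Q\<close> is the compression of \<open>S\<close> to \<open>M\<close>.
\<close>

definition upper_block :: "'a::chilbert_space set \<Rightarrow> 'a set \<Rightarrow> ('a \<Rightarrow> 'a) \<Rightarrow>
    ('a \<Rightarrow> 'a) \<Rightarrow> ('a \<Rightarrow> 'a) \<Rightarrow> ('a \<Rightarrow> 'a) \<Rightarrow> bool"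
  where "upper_block L M S V G Q \<longleftrightarrow>
    bounded_op L L V \<and> bounded_op M L G \<and> bounded_op M M Q \<and>
    (\<forall>l\<in>L. \<forall>m\<in>M. S (l + m) = (V l + G m) + Q m)"


section \<open>Liftings\<close>

text \<open>
  The inclusion of \<open>H\<close> into a larger Hilbert space is a linear isometry \<open>J\<close> from the type of \<open>H\<close>
  to that of the larger space, so that \<open>H\<close> is identified with \<open>range J\<close> (closed, as \<open>H\<close> is
  complete).
\<close>

definition proj_onto :: "('h::chilbert_space \<Rightarrow> 'k::chilbert_space) \<Rightarrow> 'k \<Rightarrow> 'h"
  where "proj_onto J x = inv J (proj (range J) x)"

definition ominus_H :: "('h::chilbert_space \<Rightarrow> 'k::chilbert_space) \<Rightarrow> 'k set"
  where "ominus_H J = {x. \<forall>h. cinner x (J h) = 0}"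

definition lifting :: "('h::chilbert_space \<Rightarrow> 'k::chilbert_space) \<Rightarrow> 'k set \<Rightarrow>
    ('k \<Rightarrow> 'k) \<Rightarrow> ('h \<Rightarrow> 'h) \<Rightarrow> bool"
  where "lifting J M S T \<longleftrightarrow> isometry_op UNIV M J \<and> bounded_op M M S \<and>
    (\<forall>x\<in>M. proj_onto J (S x) = T (proj_onto J x))"

end

theory Submission
  imports Defs
begin

text \<open>
  \<^bold>\<open>Second half.\<close> Since \<open>V\<close> is isometric and its range is orthogonal to that of \<open>G\<close>, one has
  \<open>(norm (S m))\<^sup>2 = (norm (G m))\<^sup>2 + (norm (Q m))\<^sup>2\<close> and
  \<open>(norm (S (S m)))\<^sup>2 = (norm (G m))\<^sup>2 + (norm (G (Q m)))\<^sup>2 + (norm (Q (Q m)))\<^sup>2\<close> for \<open>m \<in> M\<close>. An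
  operator \<open>S\<close> is a quasi-isometry iff \<open>norm (S (S x)) = norm (S x)\<close> for all \<open>x\<close>, so the lifting \<open>Q\<close>
  is one iff \<open>G (Q m) = 0\<close> for all \<open>m\<close>. Both \<open>adj M G ` L \<subseteq> ker M (adj M Q)\<close> and
  \<open>S ` (Q ` M) \<subseteq> Q ` M\<close> are reformulations of \<open>Q ` M \<subseteq> ker M G\<close>. What remains is that the kernels of
  the adjoints of \<open>Q\<close> and \<open>S\<close> agree iff \<open>Q ` M \<subseteq> range S\<close>. In one direction, project \<open>Q m\<close> to the
  closed subspace \<open>range S\<close>. In the other, \<open>Q m = S (l + m')\<close> forces \<open>l = 0\<close> and \<open>G m' = 0\<close>; hence
  \<open>range S\<close> contains the ranges of \<open>V\<close> and \<open>G\<close>, whose sum is dense in \<open>L\<close>.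

  \<^bold>\<open>First half.\<close> A positive operator \<open>P\<close> factors through sequences: there is \<open>D\<close> with values in
  \<open>ell2\<close> and \<open>(norm (D h))\<^sup>2 = inner (P h) h\<close> (\<open>positive_op_factorization\<close>). Let \<open>A \<ge> 1\<close> implement
  the similarity of \<open>T\<close> to a contraction. Adjoining to \<open>T h\<close> the vector \<open>D\<^sub>2 (T h)\<close>, where \<open>D\<^sub>2\<close>
  factors \<open>A - 1\<close>, and a shift fed by \<open>D\<^sub>1 h\<close>, where \<open>D\<^sub>1\<close> factors \<open>A - T\<^sup>* A T\<close>, produces a
  quasi-isometric lifting \<open>Q0\<close> of \<open>T\<close> on some space \<open>\<M>\<close> (\<open>quasi_isometric_lifting_exists\<close>).

  Such a \<open>Q0\<close> is an isometry on the closure \<open>R\<close> of its range, but it need not be injective, whereas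
  an operator similar to an isometry is bounded below. This is repaired by an isometry \<open>V\<close> on
  sequences over \<open>\<M>\<close> that fixes all components in \<open>R\<close> and shifts the components orthogonal to \<open>R\<close>. The vacancy in the
  first entry is a copy of the orthogonal complement of \<open>R\<close>, and \<open>G\<close> fills it with the component of
  \<open>m\<close> orthogonal to \<open>R\<close>. By construction \<open>G\<close> has kernel \<open>R\<close> and range the defect space of \<open>V\<close>, and
  \<open>S = (V, G; 0, Q0)\<close> is a quasi-isometry that is bounded below. A quasi-isometry that is bounded below
  is similar to an isometry through a square root of a multiple of \<open>S\<^sup>* S\<close>
  (\<open>similar_to_isometry_if_bounded_below\<close>). Finally all the spaces of sequences used here are identified
  with \<open>('h \<times> complex) ell2\<close> by enumerating pairs of natural numbers.
\<close>

section \<open>Orthogonality\<close>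

instance chilbert_space \<subseteq> banach ..

lemma scaleC_zero_right [simp]: "c *\<^sub>C 0 = (0 :: 'a::complex_inner)"
  using scaleC_add_right[of c 0 "0::'a"] by simp

lemma scaleC_minus_one: "(- 1) *\<^sub>C x = - (x :: 'a::complex_inner)"
  using scaleC_of_real[of "- 1" x] by simp

lemma scaleC_minus_right: "c *\<^sub>C (- x) = - (c *\<^sub>C (x :: 'a::complex_inner))"
  using scaleC_add_right[of c x "- x"] by (simp add: eq_neg_iff_add_eq_0 add.commute)

lemma scaleC_diff_right: "c *\<^sub>C (x - y) = c *\<^sub>C x - c *\<^sub>C (y :: 'a::complex_inner)"
  using scaleC_add_right[of c x "- y"] by (simp add: scaleC_minus_right)

lemma cinner_add_right: "cinner x (y + z) = cinner x y + cinner x (z :: 'a::complex_inner)"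
  by (metis cinner_add_left cinner_commute complex_cnj_add)

lemma cinner_zero_left [simp]: "cinner 0 x = 0"
  using cinner_add_left[of 0 0 x] by simp

lemma cinner_zero_right [simp]: "cinner x 0 = 0"
  using cinner_add_right[of x 0 0] by simp

lemma cinner_diff_left: "cinner (x - y) z = cinner x z - cinner y (z :: 'a::complex_inner)"
  using cinner_add_left[of "x - y" y z] by simp

lemma cinner_diff_right: "cinner x (y - z) = cinner x y - cinner x (z :: 'a::complex_inner)"
  using cinner_add_right[of x "y - z" z] by simp

lemma cinner_eq_0_commute: "cinner x y = 0 \<longleftrightarrow> cinner y x = 0"
  using cinner_commute[of x y] cinner_commute[of y x] by auto

lemma cinner_self_eq_0 [simp]: "cinner x x = 0 \<longleftrightarrow> x = 0"
  by (simp add: cinner_self)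

lemma norm_add_sq_orth:
  assumes "cinner x y = 0"
  shows "(norm (x + y))\<^sup>2 = (norm x)\<^sup>2 + (norm y)\<^sup>2"
proof -
  have "inner x y = 0"
    using assms by (simp flip: Re_cinner)
  then show ?thesis
    by (simp add: power2_norm_eq_inner inner_add_left inner_add_right inner_commute)
qed

lemma cinner_eq_Complex: "cinner x y = Complex (inner x y) (inner x (\<i> *\<^sub>C y))"
  by (simp add: complex_eq_iff Re_cinner[symmetric] cinner_scaleC_right)

lemma bounded_bilinear_cinner: "bounded_bilinear (cinner :: 'a::complex_inner \<Rightarrow> _)"
proof
  fix x y :: 'a and r :: real
  show "cinner (r *\<^sub>R x) y = r *\<^sub>R cinner x y"
    using cinner_scaleC_left[of "complex_of_real r" x y]
    by (simp only: scaleC_of_real scaleR_conv_of_real)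
  show "cinner x (r *\<^sub>R y) = r *\<^sub>R cinner x y"
    using cinner_scaleC_right[of x "complex_of_real r" y]
    by (simp only: scaleC_of_real scaleR_conv_of_real complex_cnj_complex_of_real)
  show "\<exists>K. \<forall>a b :: 'a. norm (cinner a b) \<le> norm a * norm b * K"
    by (rule exI[of _ 1]) (simp add: norm_cinner_le)
qed (simp_all add: cinner_add_left cinner_add_right)

lemmas continuous_on_cinner = bounded_bilinear.continuous_on[OF bounded_bilinear_cinner]

lemma closed_subspace_UNIV [simp]: "closed_subspace UNIV"
  by (simp add: closed_subspace_def)

lemma closed_subspaceD:
  assumes "closed_subspace X"
  shows "0 \<in> X" "\<And>x y. x \<in> X \<Longrightarrow> y \<in> X \<Longrightarrow> x + y \<in> X" "\<And>c x. x \<in> X \<Longrightarrow> c *\<^sub>C x \<in> X"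
    "closed X" "\<And>x y. x \<in> X \<Longrightarrow> y \<in> X \<Longrightarrow> x - y \<in> X" "\<And>r x. x \<in> X \<Longrightarrow> r *\<^sub>R x \<in> X"
proof -
  show "x - y \<in> X" if "x \<in> X" "y \<in> X" for x y
  proof -
    have "x + (- 1) *\<^sub>C y \<in> X"
      using assms that unfolding closed_subspace_def by blast
    then show ?thesis
      by (simp add: scaleC_minus_one)
  qed
  show "r *\<^sub>R x \<in> X" if "x \<in> X" for r x
    using assms that unfolding closed_subspace_def scaleC_of_real[symmetric] by blast
qed (use assms in \<open>auto simp: closed_subspace_def\<close>)

text \<open>
  A minimizing sequence is Cauchy by the parallelogram identity, because midpoints of points of
  \<open>X\<close> are again in \<open>X\<close> and hence not closer to \<open>x\<close> than the infimum allows.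
\<close>

lemma nearest_point_exists:
  assumes X: "closed_subspace X"
  shows "\<exists>y\<in>X. \<forall>z\<in>X. norm (x - y) \<le> norm (x - z)"
proof -
  define \<delta> where "\<delta> = (INF z\<in>X. (norm (x - z))\<^sup>2)"
  have bdd: "bdd_below ((\<lambda>z. (norm (x - z))\<^sup>2) ` X)"
    by (rule bdd_belowI2[of _ 0]) simp
  have lower: "\<delta> \<le> (norm (x - z))\<^sup>2" if "z \<in> X" for z
    unfolding \<delta>_def by (rule cINF_lower[OF bdd that])
  have "\<exists>z\<in>X. (norm (x - z))\<^sup>2 < \<delta> + 1 / real (Suc n)" for n
    using cINF_less_iff[OF _ bdd, of "\<delta> + 1 / real (Suc n)"] closed_subspaceD(1)[OF X]
    unfolding \<delta>_def[symmetric] by auto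
  then obtain z where z: "\<And>n. z n \<in> X" "\<And>n. (norm (x - z n))\<^sup>2 < \<delta> + 1 / real (Suc n)"
    by metis
  have close: "(dist (z n) (z m))\<^sup>2 \<le> 2 / real (Suc n) + 2 / real (Suc m)" for n m
  proof -
    define w where "w = (1 / 2) *\<^sub>R (z n + z m)"
    have "w \<in> X"
      unfolding w_def by (intro closed_subspaceD[OF X] z)
    moreover have "(dist (z n) (z m))\<^sup>2 =
        2 * (norm (x - z n))\<^sup>2 + 2 * (norm (x - z m))\<^sup>2 - 4 * (norm (x - w))\<^sup>2"
      by (simp add: w_def dist_norm power2_norm_eq_inner inner_diff_left inner_diff_right
          inner_add_left inner_add_right inner_commute algebra_simps)
    ultimately show ?thesis
      using lower[of w] z(2)[of n] z(2)[of m] by argo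
  qed
  have "Cauchy z"
  proof (rule metric_CauchyI)
    fix e :: real
    assume "e > 0"
    then obtain N where N: "4 / real (Suc N) < e\<^sup>2"
      using reals_Archimedean[of "e\<^sup>2 / 4"] by (auto simp: field_simps)
    have "dist (z m) (z n) < e" if "m \<ge> N" "n \<ge> N" for m n
    proof -
      have "2 / real (Suc k) \<le> 2 / real (Suc N)" if "k \<ge> N" for k
        using that by (intro divide_left_mono) auto
      from close[of m n] this[OF that(1)] this[OF that(2)]
      have "(dist (z m) (z n))\<^sup>2 \<le> 4 / real (Suc N)"
        by linarith
      with N have "(dist (z m) (z n))\<^sup>2 < e\<^sup>2"
        by linarith
      then show ?thesis
        using \<open>e > 0\<close> by (simp add: power2_less_imp_less)
    qed
    then show "\<exists>M. \<forall>m\<ge>M. \<forall>n\<ge>M. dist (z m) (z n) < e"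
      by blast
  qed
  then obtain y where y: "z \<longlonglongrightarrow> y"
    using Cauchy_convergent convergent_def by blast
  have "y \<in> X"
    using closed_sequentially[OF closed_subspaceD(4)[OF X] z(1) y] .
  have "(norm (x - y))\<^sup>2 \<le> \<delta>"
  proof (rule LIMSEQ_le)
    show "(\<lambda>n. (norm (x - z n))\<^sup>2) \<longlonglongrightarrow> (norm (x - y))\<^sup>2"
      by (intro tendsto_intros y)
    show "(\<lambda>n. \<delta> + 1 / real (Suc n)) \<longlonglongrightarrow> \<delta>"
      using tendsto_add[OF tendsto_const LIMSEQ_inverse_real_of_nat, of \<delta>]
      by (simp add: divide_inverse)
  qed (use z(2) less_imp_le in blast)
  then have "norm (x - y) \<le> norm (x - w)" if "w \<in> X" for w
    using lower[OF that] by (meson norm_ge_zero order_trans power2_le_imp_le)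
  with \<open>y \<in> X\<close> show ?thesis
    by blast
qed

lemma proj_ex1:
  assumes X: "closed_subspace X"
  shows "\<exists>!y. y \<in> X \<and> (\<forall>z\<in>X. cinner (x - y) z = 0)"
proof -
  obtain y where y: "y \<in> X" "\<And>z. z \<in> X \<Longrightarrow> norm (x - y) \<le> norm (x - z)"
    using nearest_point_exists[OF X] by blast
  have real_orth: "inner (x - y) z = 0" if z: "z \<in> X" for z
  proof (rule ccontr)
    assume "inner (x - y) z \<noteq> 0"
    then have pos: "(norm z)\<^sup>2 > 0"
      by auto
    \<comment> \<open>Moving from \<open>y\<close> along \<open>z\<close> to the foot of the perpendicular would decrease the distance.\<close>
    define t where "t = inner (x - y) z / (norm z)\<^sup>2"
    have "norm (x - y) \<le> norm (x - (y + t *\<^sub>R z))"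
      by (intro y closed_subspaceD[OF X] z)
    then have "(norm (x - y))\<^sup>2 \<le> (norm ((x - y) - t *\<^sub>R z))\<^sup>2"
      by (simp add: power_mono diff_diff_eq)
    also have "\<dots> = (norm (x - y))\<^sup>2 - 2 * t * inner (x - y) z + t\<^sup>2 * (norm z)\<^sup>2"
      unfolding power2_norm_eq_inner
      by (simp add: inner_diff_left inner_diff_right inner_commute algebra_simps power2_eq_square)
    also have "\<dots> = (norm (x - y))\<^sup>2 - (inner (x - y) z)\<^sup>2 / (norm z)\<^sup>2"
      using pos by (simp add: t_def power2_eq_square field_simps)
    finally have "(inner (x - y) z)\<^sup>2 / (norm z)\<^sup>2 \<le> 0"
      by simp
    with pos \<open>inner (x - y) z \<noteq> 0\<close> show False
      by (simp add: divide_le_0_iff)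
  qed
  have orth: "cinner (x - y) z = 0" if z: "z \<in> X" for z
    unfolding cinner_eq_Complex
    by (simp add: real_orth z closed_subspaceD(3)[OF X] complex_eq_iff)
  show ?thesis
  proof (rule ex1I[of _ y])
    fix y'
    assume y': "y' \<in> X \<and> (\<forall>z\<in>X. cinner (x - y') z = 0)"
    then have "y' - y \<in> X"
      using closed_subspaceD(5)[OF X] y by blast
    then have "cinner (x - y) (y' - y) - cinner (x - y') (y' - y) = 0"
      using orth y' by simp
    then show "y' = y"
      by (simp flip: cinner_diff_left)
  qed (use y orth in blast)
qed

lemma proj_in: "closed_subspace X \<Longrightarrow> proj X x \<in> X"
  and proj_orth: "closed_subspace X \<Longrightarrow> z \<in> X \<Longrightarrow> cinner (x - proj X x) z = 0"
  using theI'[OF proj_ex1[of X x]] unfolding proj_def by blast+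

lemma proj_eqI:
  assumes "closed_subspace X" "y \<in> X" "\<And>z. z \<in> X \<Longrightarrow> cinner (x - y) z = 0"
  shows "proj X x = y"
  unfolding proj_def using assms by (intro the1_equality[OF proj_ex1]) auto

lemma proj_same_iff: "closed_subspace X \<Longrightarrow> proj X x = x \<longleftrightarrow> x \<in> X"
  using proj_in[of X x] by (auto intro: proj_eqI)

lemma orth_decompD:
  assumes "orth_decomp L M"
  shows "closed_subspace L" "closed_subspace M" "\<And>l m. l \<in> L \<Longrightarrow> m \<in> M \<Longrightarrow> cinner l m = 0"
    "\<And>x. \<exists>l\<in>L. \<exists>m\<in>M. x = l + m"
  using assms unfolding orth_decomp_def by blast+

section \<open>Bounded operators and their adjoints\<close>

lemma bounded_opD:
  assumes "bounded_op X Y A"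
  shows "\<And>x. x \<in> X \<Longrightarrow> A x \<in> Y" "\<And>x y. x \<in> X \<Longrightarrow> y \<in> X \<Longrightarrow> A (x + y) = A x + A y"
    "\<And>c x. x \<in> X \<Longrightarrow> A (c *\<^sub>C x) = c *\<^sub>C A x"
  using assms unfolding bounded_op_def by blast+

lemma bounded_op_zero: "bounded_op X Y A \<Longrightarrow> closed_subspace X \<Longrightarrow> A 0 = 0"
  using bounded_opD(2)[of X Y A 0 0] by (simp add: closed_subspaceD)

lemma bounded_op_diff:
  assumes "bounded_op X Y A" "closed_subspace X" "x \<in> X" "y \<in> X"
  shows "A (x - y) = A x - A y"
  using bounded_opD(2)[OF assms(1), of "x - y" y] closed_subspaceD(5)[OF assms(2)] assms by simp

lemma bounded_op_pos_bound:
  assumes "bounded_op X Y A"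
  obtains B where "B > 0" "\<And>x. x \<in> X \<Longrightarrow> norm (A x) \<le> B * norm x"
proof -
  obtain B where B: "\<And>x. x \<in> X \<Longrightarrow> norm (A x) \<le> B * norm x"
    using assms unfolding bounded_op_def by blast
  have "norm (A x) \<le> (\<bar>B\<bar> + 1) * norm x" if "x \<in> X" for x
    by (rule order_trans[OF B[OF that]]) (simp add: mult_right_mono)
  then show thesis
    by (intro that[of "\<bar>B\<bar> + 1"]) auto
qed

lemma bounded_op_UNIV_iff:
  "bounded_op UNIV Y A \<longleftrightarrow> range A \<subseteq> Y \<and> bounded_linear A \<and> (\<forall>c x. A (c *\<^sub>C x) = c *\<^sub>C A x)"
proof
  assume A: "bounded_op UNIV Y A"
  obtain B where "\<And>x. norm (A x) \<le> B * norm x"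
    using bounded_op_pos_bound[OF A] by auto
  then have "bounded_linear A"
    using bounded_opD[OF A]
    by (intro bounded_linear_intro[of _ B])
      (auto simp: mult.commute simp flip: scaleC_of_real)
  then show "range A \<subseteq> Y \<and> bounded_linear A \<and> (\<forall>c x. A (c *\<^sub>C x) = c *\<^sub>C A x)"
    using bounded_opD[OF A] by auto
next
  assume "range A \<subseteq> Y \<and> bounded_linear A \<and> (\<forall>c x. A (c *\<^sub>C x) = c *\<^sub>C A x)"
  then show "bounded_op UNIV Y A"
    unfolding bounded_op_def
    by (auto simp: linear_add bounded_linear.linear mult.commute intro: bounded_linear.bounded
        dest!: bounded_linear.bounded) (metis mult.commute)
qed

text \<open>
  Riesz representation: the functional \<open>f x = cinner (A x) y\<close> is represented by a multiple of a
  vector \<open>w\<close> orthogonal to its kernel.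
\<close>

lemma adj_ex1:
  assumes X: "closed_subspace X" and A: "bounded_op X Y A"
  shows "\<exists>!z. z \<in> X \<and> (\<forall>x\<in>X. cinner (A x) y = cinner x z)"
proof -
  define N where "N = {x \<in> X. cinner (A x) y = 0}"
  obtain B where B: "B > 0" "\<And>x. x \<in> X \<Longrightarrow> norm (A x) \<le> B * norm x"
    using bounded_op_pos_bound[OF A] by blast
  have "closed N"
    unfolding closed_sequential_limits
  proof safe
    fix u l
    assume u: "\<forall>n. u n \<in> N" and l: "u \<longlonglongrightarrow> l"
    have lX: "l \<in> X"
      using closed_sequentially[OF closed_subspaceD(4)[OF X] _ l] u by (simp add: N_def)
    have "cmod (cinner (A l) y) \<le> B * norm (l - u n) * norm y" for n
    proof -
      have uX: "u n \<in> X" and un: "cinner (A (u n)) y = 0"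
        using u by (auto simp: N_def)
      have "cinner (A l) y = cinner (A (l - u n)) y"
        by (simp add: bounded_op_diff[OF A X lX uX] cinner_diff_left un)
      also have "cmod \<dots> \<le> norm (A (l - u n)) * norm y"
        by (rule norm_cinner_le)
      also have "\<dots> \<le> B * norm (l - u n) * norm y"
        by (intro mult_right_mono B closed_subspaceD(5)[OF X] lX uX norm_ge_zero)
      finally show ?thesis .
    qed
    moreover have "(\<lambda>n. B * norm (l - u n) * norm y) \<longlonglongrightarrow> B * norm (l - l) * norm y"
      by (intro tendsto_intros l)
    ultimately have "cmod (cinner (A l) y) \<le> 0"
      by (intro LIMSEQ_le_const[where x = 0]) auto
    then show "l \<in> N"
      using lX by (simp add: N_def)
  qed
  then have N: "closed_subspace N"
    using closed_subspaceD[OF X] bounded_opD[OF A] bounded_op_zero[OF A X]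
    unfolding closed_subspace_def N_def by (auto simp: cinner_add_left cinner_scaleC_left)
  have ex: "\<exists>z\<in>X. \<forall>x\<in>X. cinner (A x) y = cinner x z"
  proof (cases "X \<subseteq> N")
    case True
    then show ?thesis
      using closed_subspaceD(1)[OF X] by (intro bexI[of _ 0]) (auto simp: N_def)
  next
    case False
    then obtain u where u: "u \<in> X" "u \<notin> N"
      by blast
    define w where "w = u - proj N u"
    have wX: "w \<in> X"
      using proj_in[OF N, of u] u closed_subspaceD(5)[OF X] unfolding w_def N_def by blast
    have orth: "cinner x w = 0" if "x \<in> N" for x
      using proj_orth[OF N that, of u] unfolding w_def by (simp add: cinner_eq_0_commute)
    have w0: "w \<noteq> 0"
      using proj_in[OF N, of u] u by (auto simp: w_def)
    have fw: "cinner (A w) y \<noteq> 0"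
      using orth[of w] w0 wX by (auto simp: N_def)
    define z where "z = (cnj (cinner (A w) y) / cinner w w) *\<^sub>C w"
    have "cinner (A x) y = cinner x z" if x: "x \<in> X" for x
    proof -
      define c where "c = cinner (A x) y / cinner (A w) y"
      have cf: "c * cinner (A w) y = cinner (A x) y"
        using fw by (simp add: c_def)
      have cw: "c *\<^sub>C w \<in> X"
        by (intro closed_subspaceD[OF X] wX)
      have "x - c *\<^sub>C w \<in> N"
        unfolding N_def
        using cf closed_subspaceD(5)[OF X x cw]
        by (simp add: bounded_op_diff[OF A X x cw] bounded_opD(3)[OF A wX] cinner_diff_left
            cinner_scaleC_left)
      from orth[OF this] have "cinner x w = c * cinner w w"
        by (simp add: cinner_diff_left cinner_scaleC_left)
      then show ?thesis
        using fw w0 by (simp add: z_def cinner_scaleC_right c_def cinner_self)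
    qed
    moreover have "z \<in> X"
      unfolding z_def by (intro closed_subspaceD[OF X] wX)
    ultimately show ?thesis
      by blast
  qed
  moreover have "z = z'" if "z \<in> X" "z' \<in> X" "\<forall>x\<in>X. cinner (A x) y = cinner x z"
    "\<forall>x\<in>X. cinner (A x) y = cinner x z'" for z z'
  proof -
    have "cinner (z - z') (z - z') = 0"
      using that closed_subspaceD(5)[OF X that(1,2)] by (simp add: cinner_diff_right)
    then show ?thesis
      by simp
  qed
  ultimately show ?thesis
    by blast
qed

lemma adj_in: "closed_subspace X \<Longrightarrow> bounded_op X Y A \<Longrightarrow> adj X A y \<in> X"
  and cinner_adj_right: "closed_subspace X \<Longrightarrow> bounded_op X Y A \<Longrightarrow> x \<in> X \<Longrightarrow>
    cinner x (adj X A y) = cinner (A x) y"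
  using theI'[OF adj_ex1[of X Y A y]] unfolding adj_def by auto

lemma adj_eqI:
  assumes "closed_subspace X" "bounded_op X Y A" "z \<in> X"
    "\<And>x. x \<in> X \<Longrightarrow> cinner (A x) y = cinner x z"
  shows "adj X A y = z"
  unfolding adj_def using assms by (intro the1_equality[OF adj_ex1]) auto

lemma cinner_adj_left:
  "closed_subspace X \<Longrightarrow> bounded_op X Y A \<Longrightarrow> x \<in> X \<Longrightarrow> cinner (adj X A y) x = cinner y (A x)"
  by (metis cinner_adj_right cinner_commute)

lemma ker_adj:
  assumes "closed_subspace X" "bounded_op X Y A"
  shows "ker Z (adj X A) = {y \<in> Z. \<forall>x\<in>X. cinner (A x) y = 0}"
proof -
  have "adj X A y = 0 \<longleftrightarrow> (\<forall>x\<in>X. cinner (A x) y = 0)" for y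
    using adj_eqI[OF assms closed_subspaceD(1)[OF assms(1)], of y]
      cinner_adj_right[OF assms, of _ y] by auto
  then show ?thesis
    by (auto simp: ker_def)
qed

lemma bounded_op_adj:
  assumes A: "bounded_op UNIV UNIV A"
  shows "bounded_op UNIV UNIV (adj UNIV A)"
proof -
  note cadj = cinner_adj_right[OF closed_subspace_UNIV A UNIV_I]
  note eqI = adj_eqI[OF closed_subspace_UNIV A UNIV_I]
  obtain B where B: "B > 0" "\<And>x. norm (A x) \<le> B * norm x"
    using bounded_op_pos_bound[OF A] by auto
  have "norm (adj UNIV A y) \<le> B * norm y" for y
  proof (cases "adj UNIV A y = 0")
    case False
    have "(norm (adj UNIV A y))\<^sup>2 = cmod (cinner (A (adj UNIV A y)) y)"
      by (simp flip: cadj add: cinner_self norm_power)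
    also have "\<dots> \<le> norm (A (adj UNIV A y)) * norm y"
      by (rule norm_cinner_le)
    also have "\<dots> \<le> (B * norm (adj UNIV A y)) * norm y"
      by (intro mult_right_mono B norm_ge_zero)
    finally show ?thesis
      using False by (simp add: power2_eq_square)
  qed (use B in simp)
  moreover have "adj UNIV A (x + y) = adj UNIV A x + adj UNIV A y" for x y
    by (rule eqI) (simp add: cinner_add_right cadj)
  moreover have "adj UNIV A (c *\<^sub>C x) = c *\<^sub>C adj UNIV A x" for c x
    by (rule eqI) (simp add: cinner_scaleC_right cadj)
  ultimately show ?thesis
    unfolding bounded_op_def by blast
qed

text \<open>Polarization: the norms of the images of all vectors determine all inner products.\<close>

lemma cinner_eq_if_norm_eq:
  assumes X: "closed_subspace X" and f: "bounded_op X Y f" and g: "bounded_op X Z g"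
    and norm: "\<And>x. x \<in> X \<Longrightarrow> norm (f x) = norm (g x)"
    and x: "x \<in> X" and y: "y \<in> X"
  shows "cinner (f x) (f y) = cinner (g x) (g y)"
proof -
  have "inner (f x) (f y) = inner (g x) (g y)" if "y \<in> X" for y
  proof -
    have "norm (f x + f y) = norm (g x + g y)"
      using norm[of "x + y"] closed_subspaceD(2)[OF X x that]
      by (simp add: bounded_opD(2)[OF f x that] bounded_opD(2)[OF g x that])
    then show ?thesis
      by (simp add: dot_norm norm x that)
  qed
  from this[OF y] this[of "\<i> *\<^sub>C y"] closed_subspaceD(3)[OF X y, of \<i>] show ?thesis
    unfolding cinner_eq_Complex by (simp add: bounded_opD(3)[OF f y] bounded_opD(3)[OF g y])
qed

lemma bounded_op_compose:
  assumes "bounded_op X Y f" "bounded_op Y Z g"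
  shows "bounded_op X Z (g \<circ> f)"
proof -
  obtain B C where B: "B > 0" "\<And>x. x \<in> X \<Longrightarrow> norm (f x) \<le> B * norm x"
    and C: "C > 0" "\<And>x. x \<in> Y \<Longrightarrow> norm (g x) \<le> C * norm x"
    using bounded_op_pos_bound assms by metis
  have "norm (g (f x)) \<le> (C * B) * norm x" if "x \<in> X" for x
    using C(2)[OF bounded_opD(1)[OF assms(1) that]] B(2)[OF that] C(1)
    by (smt (verit, best) mult.assoc mult_left_mono)
  then show ?thesis
    using bounded_opD[OF assms(1)] bounded_opD[OF assms(2)] unfolding bounded_op_def by auto
qed

text \<open>
  The identity \<open>S\<^sup>*\<^sup>2 S\<^sup>2 = S\<^sup>* S\<close> compares the quadratic forms \<open>(norm (S (S x)))\<^sup>2\<close> and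
  \<open>(norm (S x))\<^sup>2\<close>, which determine the two operators by polarization.
\<close>

lemma quasi_isometry_iff:
  assumes X: "closed_subspace X"
  shows "quasi_isometry X S \<longleftrightarrow> bounded_op X X S \<and> (\<forall>x\<in>X. norm (S (S x)) = norm (S x))"
proof (cases "bounded_op X X S")
  case S: True
  have SX: "S x \<in> X" if "x \<in> X" for x
    using bounded_opD(1)[OF S that] .
  note cadj = cinner_adj_right[OF X S]
  have "(\<forall>x\<in>X. adj X S (adj X S (S (S x))) = adj X S (S x)) \<longleftrightarrow>
      (\<forall>x\<in>X. norm (S (S x)) = norm (S x))"
  proof safe
    fix x
    assume *: "\<forall>x\<in>X. adj X S (adj X S (S (S x))) = adj X S (S x)" and x: "x \<in> X"
    have "cinner (S (S x)) (S (S x)) = cinner x (adj X S (adj X S (S (S x))))"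
      by (simp add: cadj x SX)
    also have "\<dots> = cinner (S x) (S x)"
      using * x by (simp add: cadj)
    finally have "(norm (S (S x)))\<^sup>2 = (norm (S x))\<^sup>2"
      unfolding cinner_self of_real_eq_iff .
    then show "norm (S (S x)) = norm (S x)"
      by simp
  next
    fix x
    assume *: "\<forall>x\<in>X. norm (S (S x)) = norm (S x)" and x: "x \<in> X"
    have "cinner (S (S y)) (S (S x)) = cinner (S y) (S x)" if "y \<in> X" for y
      using cinner_eq_if_norm_eq[OF X bounded_op_compose[OF S S] S _ that x] * by simp
    then have "adj X S (S x) = adj X S (adj X S (S (S x)))"
      by (intro adj_eqI[OF X S] adj_in[OF X S]) (simp add: cadj SX)
    then show "adj X S (adj X S (S (S x))) = adj X S (S x)" ..
  qed
  with S show ?thesis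
    by (simp add: quasi_isometry_def)
qed (simp add: quasi_isometry_def)

lemma closed_subspace_range:
  assumes S: "bounded_op UNIV Y S" and below: "\<And>x. norm x \<le> C * norm (S x)"
  shows "closed_subspace (range S)"
proof -
  have "norm x * (1 / (\<bar>C\<bar> + 1)) \<le> norm (S x)" for x
    using order_trans[OF below[of x] mult_right_mono[of C "\<bar>C\<bar> + 1" "norm (S x)"]]
    by (simp add: field_simps)
  moreover have "bounded_linear S"
    using S by (simp add: bounded_op_UNIV_iff)
  ultimately have "complete (range S)"
    by (intro complete_isometric_image[of "1 / (\<bar>C\<bar> + 1)"])
      (auto simp: complete_UNIV mult.commute)
  moreover have "0 \<in> range S"
    using bounded_op_zero[OF S] by (metis closed_subspace_UNIV rangeI)
  ultimately show ?thesis
    using bounded_opD(2,3)[OF S, symmetric]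
    unfolding closed_subspace_def by (auto simp: complete_imp_closed)
qed

text \<open>A left inverse of \<open>S\<^sup>* S\<close> yields one of \<open>S\<close>, so \<open>S\<close> is bounded below.\<close>

lemma left_invertible_closed_range:
  assumes "left_invertible UNIV S"
  shows "closed_subspace (range S)"
proof -
  have S: "bounded_op UNIV UNIV S"
    using assms by (simp add: left_invertible_def)
  obtain R where R: "bounded_op UNIV UNIV R" "\<And>x. R (adj UNIV S (S x)) = x"
    using assms unfolding left_invertible_def invertible_op_def by auto
  obtain C where C: "C > 0" "\<And>x. norm ((R \<circ> adj UNIV S) x) \<le> C * norm x"
    using bounded_op_pos_bound[OF bounded_op_compose[OF bounded_op_adj[OF S] R(1)]] by auto
  show ?thesis
    using C(2)[of "S _"] R(2) by (intro closed_subspace_range[OF S]) simp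
qed

section \<open>Liftings\<close>

lemma isometry_opD:
  assumes "isometry_op X Y A"
  shows "bounded_op X Y A" "\<And>x. x \<in> X \<Longrightarrow> norm (A x) = norm x"
  using assms by (auto simp: isometry_op_def)

lemma bounded_op_id [simp]: "bounded_op X X (\<lambda>x. x)"
  by (auto simp: bounded_op_def intro: exI[of _ 1])

lemma isometry_cinner:
  assumes "closed_subspace X" "isometry_op X Y A" "x \<in> X" "y \<in> X"
  shows "cinner (A x) (A y) = cinner x y"
  using cinner_eq_if_norm_eq[OF assms(1) isometry_opD(1)[OF assms(2)] bounded_op_id] assms
  by (simp add: isometry_opD)

lemma isometry_inj:
  assumes "isometry_op UNIV Y A"
  shows "inj A"
proof (rule injI)
  fix x y
  assume "A x = A y"
  then have "norm (A (x - y)) = 0"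
    by (simp add: bounded_op_diff[OF isometry_opD(1)[OF assms] closed_subspace_UNIV])
  then show "x = y"
    by (simp add: isometry_opD(2)[OF assms])
qed

lemma isometry_closed_range: "isometry_op UNIV Y A \<Longrightarrow> closed_subspace (range A)"
  using closed_subspace_range[of Y A 1] by (simp add: isometry_op_def)

lemma proj_onto_eqI:
  assumes J: "isometry_op UNIV Y J" and "\<And>h'. cinner (x - J h) (J h') = 0"
  shows "proj_onto J x = h"
proof -
  have "proj (range J) x = J h"
    using assms(2) by (intro proj_eqI isometry_closed_range[OF J]) auto
  then show ?thesis
    by (simp add: proj_onto_def inv_f_f[OF isometry_inj[OF J]])
qed

lemma proj_onto_orth:
  assumes J: "isometry_op UNIV Y J"
  shows "cinner (x - J (proj_onto J x)) (J h) = 0"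
proof -
  note R = isometry_closed_range[OF J]
  have "J (proj_onto J x) = proj (range J) x"
    by (simp add: proj_onto_def f_inv_into_f proj_in[OF R])
  then show ?thesis
    by (simp add: proj_orth[OF R])
qed

lemma proj_onto_cong:
  assumes J: "isometry_op UNIV Y J" and "\<And>h. cinner x (J h) = cinner y (J h)"
  shows "proj_onto J x = proj_onto J y"
  using proj_onto_orth[OF J, of y] assms(2) by (intro proj_onto_eqI[OF J]) (simp add: cinner_diff_left)

section \<open>Liftings in block form\<close>

text \<open>
  Liftings in block form whose corner \<open>V\<close> is an isometry with defect space the closure of the range
  of \<open>G\<close>. Both halves of the theorem are about such liftings.
\<close>

locale block_lifting =
  fixes J :: "'h::chilbert_space \<Rightarrow> 'k::chilbert_space" and T S L M V G Q
  assumes lift: "lifting J UNIV S T"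
    and decomp: "orth_decomp L M"
    and block: "upper_block L M S V G Q"
    and L_orth: "L \<subseteq> ominus_H J"
    and V_iso: "isometry_op L L V"
    and defect: "ker L (adj L V) = closure (G ` M)"
begin

lemmas L = orth_decompD(1)[OF decomp] and M = orth_decompD(2)[OF decomp]
lemmas LM = orth_decompD(3)[OF decomp]

lemma V: "bounded_op L L V" and G: "bounded_op M L G" and Q: "bounded_op M M Q"
  and S_add: "l \<in> L \<Longrightarrow> m \<in> M \<Longrightarrow> S (l + m) = (V l + G m) + Q m"
  using block by (auto simp: upper_block_def)

lemma S: "bounded_op UNIV UNIV S"
  using lift by (simp add: lifting_def)

lemma S_M: "m \<in> M \<Longrightarrow> S m = G m + Q m"
  using S_add[of 0 m] closed_subspaceD(1)[OF L] by (simp add: bounded_op_zero[OF V L])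

lemma S_L: "l \<in> L \<Longrightarrow> S l = V l"
  using S_add[of l 0] closed_subspaceD(1)[OF M]
  by (simp add: bounded_op_zero[OF G M] bounded_op_zero[OF Q M])

lemma V_orth_G: "l \<in> L \<Longrightarrow> m \<in> M \<Longrightarrow> cinner (V l) (G m) = 0"
  using defect closure_subset[of "G ` M"] by (auto simp: ker_adj[OF L V])

lemma J_M: "J h \<in> M"
proof -
  obtain l m where lm: "l \<in> L" "m \<in> M" "J h = l + m"
    using orth_decompD(4)[OF decomp] by blast
  have "cinner l (J h) = 0"
    using lm(1) L_orth unfolding ominus_H_def by blast
  then have "l = 0"
    using LM[OF lm(1,2)] by (simp add: lm(3) cinner_add_right)
  with lm show ?thesis
    by simp
qed

lemma lifting_compression: "lifting J M Q T"
proof -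
  have J: "isometry_op UNIV UNIV J" and ST: "proj_onto J (S x) = T (proj_onto J x)" for x
    using lift by (auto simp: lifting_def)
  have "proj_onto J (S m) = proj_onto J (Q m)" if "m \<in> M" for m
    using bounded_opD(1)[OF G that] L_orth
    by (intro proj_onto_cong[OF J]) (auto simp: S_M that cinner_add_left ominus_H_def)
  then have "\<forall>m\<in>M. proj_onto J (Q m) = T (proj_onto J m)"
    using ST by simp
  moreover have "isometry_op UNIV M J"
    using J J_M unfolding isometry_op_def bounded_op_def by blast
  ultimately show ?thesis
    using Q by (simp add: lifting_def)
qed

lemma norm_S_M:
  assumes "m \<in> M"
  shows "(norm (S m))\<^sup>2 = (norm (G m))\<^sup>2 + (norm (Q m))\<^sup>2"
  using LM bounded_opD(1)[OF G assms] bounded_opD(1)[OF Q assms]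
  by (simp add: S_M assms norm_add_sq_orth)

lemma norm_S_S_M:
  assumes m: "m \<in> M"
  shows "(norm (S (S m)))\<^sup>2 = (norm (G m))\<^sup>2 + (norm (G (Q m)))\<^sup>2 + (norm (Q (Q m)))\<^sup>2"
proof -
  have Gm: "G m \<in> L" and Qm: "Q m \<in> M"
    using m bounded_opD(1) G Q by blast+
  note GQm = bounded_opD(1)[OF G Qm] and QQm = bounded_opD(1)[OF Q Qm]
  have VGm: "V (G m) \<in> L"
    by (rule bounded_opD(1)[OF V Gm])
  have "(norm (S (S m)))\<^sup>2 = (norm (V (G m) + G (Q m)))\<^sup>2 + (norm (Q (Q m)))\<^sup>2"
    unfolding S_M[OF m] S_add[OF Gm Qm]
    by (intro norm_add_sq_orth LM closed_subspaceD[OF L] VGm GQm QQm)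
  also have "(norm (V (G m) + G (Q m)))\<^sup>2 = (norm (V (G m)))\<^sup>2 + (norm (G (Q m)))\<^sup>2"
    by (intro norm_add_sq_orth V_orth_G Gm Qm)
  finally show ?thesis
    by (simp add: isometry_opD(2)[OF V_iso Gm])
qed

text \<open>
  The two preceding identities turn \<open>norm (S (S m)) = norm (S m)\<close> into
  \<open>(norm (G (Q m)))\<^sup>2 + (norm (Q (Q m)))\<^sup>2 = (norm (Q m))\<^sup>2\<close>.
\<close>

lemma quasi_isometry_compression_iff:
  assumes "quasi_isometry UNIV S"
  shows "quasi_isometry M Q \<longleftrightarrow> Q ` M \<subseteq> ker M G"
proof -
  have "norm (Q (Q m)) = norm (Q m) \<longleftrightarrow> G (Q m) = 0" if "m \<in> M" for m
  proof -
    have "(norm (S (S m)))\<^sup>2 = (norm (S m))\<^sup>2"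
      using assms by (simp add: quasi_isometry_iff)
    then have "(norm (G (Q m)))\<^sup>2 + (norm (Q (Q m)))\<^sup>2 = (norm (Q m))\<^sup>2"
      by (simp add: norm_S_M norm_S_S_M that)
    moreover have "norm (Q (Q m)) = norm (Q m) \<longleftrightarrow> (norm (Q (Q m)))\<^sup>2 = (norm (Q m))\<^sup>2"
      by simp
    ultimately show ?thesis
      by (metis add_cancel_right_left norm_eq_zero zero_eq_power2)
  qed
  then show ?thesis
    using Q bounded_opD(1)[OF Q] by (auto simp: quasi_isometry_iff[OF M] ker_def)
qed

text \<open>A vector of \<open>M\<close> is orthogonal to the ranges of \<open>V\<close> and \<open>G\<close>, which lie in \<open>L\<close>.\<close>

lemma ker_adj_compression_subset: "ker M (adj M Q) \<subseteq> ker UNIV (adj UNIV S)"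
proof
  fix y
  assume "y \<in> ker M (adj M Q)"
  then have y: "y \<in> M" "\<And>m. m \<in> M \<Longrightarrow> cinner (Q m) y = 0"
    by (auto simp: ker_adj[OF M Q])
  have "cinner (S x) y = 0" for x
  proof -
    obtain l m where lm: "l \<in> L" "m \<in> M" "x = l + m"
      using orth_decompD(4)[OF decomp] by blast
    then show ?thesis
      using LM[OF bounded_opD(1)[OF V lm(1)] y(1)] LM[OF bounded_opD(1)[OF G lm(2)] y(1)]
      by (simp add: S_add cinner_add_left y)
  qed
  then show "y \<in> ker UNIV (adj UNIV S)"
    by (simp add: ker_adj[OF closed_subspace_UNIV S])
qed

lemma range_adj_subset_iff: "adj M G ` L \<subseteq> ker M (adj M Q) \<longleftrightarrow> Q ` M \<subseteq> ker M G"
proof -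
  have "adj M G ` L \<subseteq> ker M (adj M Q) \<longleftrightarrow> (\<forall>l\<in>L. \<forall>m\<in>M. cinner (G (Q m)) l = 0)"
    using bounded_opD(1)[OF Q]
    by (auto simp: ker_adj[OF M Q] adj_in[OF M G] cinner_adj_right[OF M G])
  also have "\<dots> \<longleftrightarrow> (\<forall>m\<in>M. G (Q m) = 0)"
  proof
    assume *: "\<forall>l\<in>L. \<forall>m\<in>M. cinner (G (Q m)) l = 0"
    show "\<forall>m\<in>M. G (Q m) = 0"
    proof
      fix m
      assume "m \<in> M"
      then have "G (Q m) \<in> L"
        using bounded_opD(1) G Q by blast
      with * \<open>m \<in> M\<close> show "G (Q m) = 0"
        by (metis cinner_self_eq_0)
    qed
  qed simp
  also have "\<dots> \<longleftrightarrow> Q ` M \<subseteq> ker M G"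
    using bounded_opD(1)[OF Q] by (auto simp: ker_def)
  finally show ?thesis .
qed

lemma range_invariant_iff:
  "S ` (Q ` M) \<subseteq> Q ` M \<longleftrightarrow> Q ` M \<subseteq> ker M G"
proof
  assume *: "S ` (Q ` M) \<subseteq> Q ` M"
  have "G (Q m) = 0" if m: "m \<in> M" for m
  proof -
    have Qm: "Q m \<in> M"
      by (rule bounded_opD(1)[OF Q m])
    obtain m' where m': "m' \<in> M" "S (Q m) = Q m'"
      using * m by blast
    have "G (Q m) = Q m' - Q (Q m)"
      unfolding m'(2)[symmetric] S_M[OF Qm] by simp
    then have "G (Q m) \<in> M"
      using closed_subspaceD(5)[OF M] bounded_opD(1)[OF Q] m'(1) Qm by metis
    then have "cinner (G (Q m)) (G (Q m)) = 0"
      by (intro LM bounded_opD(1)[OF G Qm])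
    then show ?thesis
      by simp
  qed
  then show "Q ` M \<subseteq> ker M G"
    using bounded_opD(1)[OF Q] by (auto simp: ker_def)
next
  assume "Q ` M \<subseteq> ker M G"
  then have "S (Q m) = Q (Q m)" if "m \<in> M" for m
    using that by (auto simp: ker_def S_M)
  then show "S ` (Q ` M) \<subseteq> Q ` M"
    using bounded_opD(1)[OF Q] by auto
qed

text \<open>
  If \<open>Q m = S (l + m')\<close>, then \<open>V l + G m' = 0\<close>; as \<open>V l\<close> and \<open>G m'\<close> are orthogonal, both vanish, so
  \<open>m\<close> and \<open>m'\<close> differ by a vector of \<open>ker M Q\<close>, on which \<open>S\<close> and \<open>G\<close> coincide.
\<close>

lemma range_G_subset:
  assumes "Q ` M \<subseteq> range S" and m: "m \<in> M"
  shows "G m \<in> range S"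
proof -
  obtain x where x: "Q m = S x"
    using assms by blast
  obtain l m' where lm: "l \<in> L" "m' \<in> M" "x = l + m'"
    using orth_decompD(4)[OF decomp] by blast
  have VG: "V l + G m' \<in> L"
    by (intro closed_subspaceD[OF L] bounded_opD(1)[OF V] bounded_opD(1)[OF G] lm)
  have eq: "V l + G m' = Q m - Q m'"
    using x by (simp add: lm S_add)
  then have "V l + G m' \<in> M"
    using closed_subspaceD(5)[OF M] bounded_opD(1)[OF Q] m lm(2) by metis
  then have VG0: "V l + G m' = 0"
    using LM[OF VG] by (metis cinner_self_eq_0)
  then have "(norm (V l))\<^sup>2 + (norm (G m'))\<^sup>2 = 0"
    using norm_add_sq_orth[OF V_orth_G[OF lm(1,2)]] by simp
  then have "G m' = 0"
    by (simp add: add_nonneg_eq_0_iff)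
  then have "S (m - m') = G m"
    using eq VG0 m lm(2)
    by (simp add: S_M closed_subspaceD(5)[OF M] bounded_op_diff[OF G M] bounded_op_diff[OF Q M])
  then show ?thesis
    by (metis rangeI)
qed

text \<open>
  When \<open>range S\<close> contains the range of \<open>G\<close>, the component in \<open>L\<close> of a vector of \<open>ker UNIV (adj UNIV S)\<close>
  is orthogonal to the ranges of \<open>V\<close> and \<open>G\<close>, which together are dense in \<open>L\<close>.
\<close>

lemma ker_adj_eq_if_range_subset:
  assumes sub: "Q ` M \<subseteq> range S"
  shows "ker M (adj M Q) = ker UNIV (adj UNIV S)"
proof
  show "ker UNIV (adj UNIV S) \<subseteq> ker M (adj M Q)"
  proof
    fix y
    assume "y \<in> ker UNIV (adj UNIV S)"
    then have y: "cinner (S x) y = 0" for x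
      by (simp add: ker_adj[OF closed_subspace_UNIV S])
    obtain l m where lm: "l \<in> L" "m \<in> M" "y = l + m"
      using orth_decompD(4)[OF decomp] by blast
    have l: "cinner z l = 0" if z: "z \<in> L" "z \<in> range S" for z
    proof -
      have "cinner z y = 0"
        using z(2) y by (metis rangeE)
      then show ?thesis
        using LM[OF z(1) lm(2)] unfolding lm(3) by (simp add: cinner_add_right)
    qed
    have "cinner (V x) l = 0" if "x \<in> L" for x
    proof (rule l)
      show "V x \<in> range S"
        unfolding S_L[OF that, symmetric] by (rule rangeI)
    qed (rule bounded_opD(1)[OF V that])
    then have "l \<in> closure (G ` M)"
      unfolding defect[symmetric] ker_adj[OF L V] using lm(1) by simp
    moreover have "G ` M \<subseteq> {z. cinner z l = 0}"
      by (auto intro!: l range_G_subset[OF sub] bounded_opD(1)[OF G])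
    moreover have "closed {z. cinner z l = 0}"
      by (intro closed_Collect_eq continuous_on_cinner continuous_intros)
    ultimately have "cinner l l = 0"
      using closure_minimal by blast
    then have "y \<in> M"
      by (simp add: lm)
    moreover have "cinner (Q m) y = 0" if "m \<in> M" for m
      using sub that y by auto
    ultimately show "y \<in> ker M (adj M Q)"
      by (simp add: ker_adj[OF M Q])
  qed
qed (rule ker_adj_compression_subset)

text \<open>
  The component of \<open>Q m\<close> orthogonal to the closed subspace \<open>range S\<close> lies in the kernel of the adjoint
  of \<open>S\<close>, hence in that of \<open>Q\<close>; so it is orthogonal to \<open>Q m\<close> and vanishes.
\<close>

lemma range_subset_if_ker_adj_eq:
  assumes left: "left_invertible UNIV S" and ker: "ker M (adj M Q) = ker UNIV (adj UNIV S)"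
  shows "Q ` M \<subseteq> range S"
proof safe
  fix m
  assume m: "m \<in> M"
  note R = left_invertible_closed_range[OF left]
  define p where "p = proj (range S) (Q m)"
  have "cinner (S x) (Q m - p) = 0" for x
    unfolding p_def using proj_orth[OF R] by (simp add: cinner_eq_0_commute)
  then have "Q m - p \<in> ker M (adj M Q)"
    unfolding ker by (simp add: ker_adj[OF closed_subspace_UNIV S])
  then have "cinner (Q m) (Q m - p) = 0"
    using m by (simp add: ker_adj[OF M Q])
  moreover have "cinner p (Q m - p) = 0"
    unfolding p_def using proj_orth[OF R proj_in[OF R]] by (simp add: cinner_eq_0_commute)
  ultimately have "cinner (Q m - p) (Q m - p) = 0"
    by (simp add: cinner_diff_left)
  then have "Q m = p"
    by simp
  then show "Q m \<in> range S"
    using proj_in[OF R, of "Q m"] unfolding p_def[symmetric] by simp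
qed

lemma ker_adj_conditions_iff:
  assumes "left_invertible UNIV S"
  shows "adj M G ` L \<subseteq> ker M (adj M Q) \<and> ker M (adj M Q) = ker UNIV (adj UNIV S) \<longleftrightarrow>
    S ` (Q ` M) \<subseteq> Q ` M \<and> Q ` M \<subseteq> range S"
  using ker_adj_eq_if_range_subset range_subset_if_ker_adj_eq[OF assms]
  unfolding range_adj_subset_iff range_invariant_iff by blast

end

section \<open>Positive operators\<close>

text \<open>Complex polarization: a quadratic form with real values is Hermitian.\<close>

lemma self_adjoint_if_nonneg:
  assumes P: "bounded_op UNIV UNIV P" and pos: "\<And>x. cinner (P x) x \<in> \<real>\<^sub>\<ge>\<^sub>0"
  shows "cinner (P x) y = cinner x (P y)"
proof -
  have Im: "Im (cinner (P z) z) = 0" for z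
    using pos[of z] by (simp add: complex_nonneg_Reals_iff)
  have add: "P (x + y) = P x + P y" for x y
    by (rule bounded_opD(2)[OF P]) auto
  have scale: "P (c *\<^sub>C x) = c *\<^sub>C P x" for c x
    by (rule bounded_opD(3)[OF P]) auto
  have "Im (cinner (P x) y) + Im (cinner (P y) x) = 0"
    using Im[of "x + y"] Im[of x] Im[of y] by (simp add: add cinner_add_left cinner_add_right)
  moreover have "Re (cinner (P x) y) = Re (cinner (P y) x)"
    using Im[of "x + \<i> *\<^sub>C y"] Im[of x] Im[of y]
    by (simp add: add scale cinner_add_left cinner_add_right cinner_scaleC_left cinner_scaleC_right)
  ultimately have "cinner (P x) y = cnj (cinner (P y) x)"
    by (simp add: complex_eq_iff)
  then show ?thesis
    by (simp flip: cinner_commute)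
qed

lemma self_adjoint_inner:
  assumes "\<And>x y. cinner (P x) y = cinner x (P y)"
  shows "inner (P x) y = inner x (P y)"
  using assms[of x y] by (simp flip: Re_cinner)

text \<open>
  The inequality is \<open>P\<^sup>2 \<le> b P\<close>, obtained from \<open>0 \<le> inner (P z) z\<close> at \<open>z = x - (1 / b) P x\<close>.
\<close>

lemma positive_op_sq_le:
  assumes P: "bounded_op UNIV UNIV P"
    and sa: "\<And>x y. cinner (P x) y = cinner x (P y)" and pos: "\<And>x. 0 \<le> inner (P x) x"
  obtains b where "b > 0" "\<And>x. (norm (P x))\<^sup>2 \<le> b * inner (P x) x"
proof -
  obtain b where b: "b > 0" "\<And>x. norm (P x) \<le> b * norm x"
    using bounded_op_pos_bound[OF P] by auto
  have lin: "linear P"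
    using P by (simp add: bounded_op_UNIV_iff bounded_linear.linear)
  have "(norm (P x))\<^sup>2 \<le> b * inner (P x) x" for x
  proof -
    have "inner (P (P x)) (P x) \<le> norm (P (P x)) * norm (P x)"
      by (rule norm_cauchy_schwarz)
    also have "\<dots> \<le> (b * norm (P x)) * norm (P x)"
      by (intro mult_right_mono b norm_ge_zero)
    finally have PP: "inner (P (P x)) (P x) \<le> b * (norm (P x))\<^sup>2"
      by (simp add: power2_eq_square mult.assoc)
    have "0 \<le> inner (P (x - (1 / b) *\<^sub>R P x)) (x - (1 / b) *\<^sub>R P x)"
      by (rule pos)
    also have "\<dots> = inner (P x) x - (2 / b) * (norm (P x))\<^sup>2 + inner (P (P x)) (P x) / b\<^sup>2"
      unfolding power2_norm_eq_inner
      by (simp add: linear_diff[OF lin] linear_scale[OF lin] inner_diff_left inner_diff_right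
          self_adjoint_inner[OF sa, of "P x" x] power2_eq_square diff_divide_distrib)
    also have "\<dots> \<le> inner (P x) x - (2 / b) * (norm (P x))\<^sup>2 + b * (norm (P x))\<^sup>2 / b\<^sup>2"
      by (intro add_left_mono divide_right_mono PP) simp
    also have "\<dots> = inner (P x) x - (norm (P x))\<^sup>2 / b"
      using b(1) by (simp add: field_simps power2_eq_square)
    finally show ?thesis
      using b(1) by (simp add: field_simps)
  qed
  with b(1) show thesis
    by (rule that)
qed

text \<open>
  For \<open>0 \<le> P \<le> 1\<close>, which is used in the form \<open>(norm (P x))\<^sup>2 \<le> inner (P x) x\<close>, the recursion \<open>P\<^bsub>n+1\<^esub> = P\<^sub>n - P\<^sub>n\<^sup>2\<close> gives \<open>P = (\<Sum>k<n. P\<^sub>k\<^sup>2) + P\<^sub>n\<close>. The remainder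
  tends to \<open>0\<close>, so that \<open>x \<mapsto> (P\<^sub>n x)\<^sub>n\<close> is a factor of \<open>P\<close>.
\<close>

primrec residual :: "('a::chilbert_space \<Rightarrow> 'a) \<Rightarrow> nat \<Rightarrow> 'a \<Rightarrow> 'a" where
  "residual P 0 = P"
| "residual P (Suc n) = (\<lambda>x. residual P n (x - residual P n x))"

lemma bounded_op_add:
  assumes f: "bounded_op UNIV UNIV f" and g: "bounded_op UNIV UNIV g"
  shows "bounded_op UNIV UNIV (\<lambda>x. f x + g x)"
  using f g unfolding bounded_op_UNIV_iff by (auto simp: bounded_linear_add scaleC_add_right)

lemma bounded_op_sub:
  assumes f: "bounded_op UNIV UNIV f" and g: "bounded_op UNIV UNIV g"
  shows "bounded_op UNIV UNIV (\<lambda>x. f x - g x)"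
  using f g unfolding bounded_op_UNIV_iff by (auto simp: bounded_linear_sub scaleC_diff_right)

lemma scaleC_scaleR_commute: "c *\<^sub>C r *\<^sub>R x = r *\<^sub>R c *\<^sub>C (x :: 'a::complex_inner)"
  by (metis mult.commute scaleC_of_real scaleC_scaleC)

lemma bounded_op_scaleR:
  assumes "bounded_op UNIV UNIV f"
  shows "bounded_op UNIV UNIV (\<lambda>x. r *\<^sub>R f x)"
  using assms unfolding bounded_op_UNIV_iff
  by (auto simp: scaleC_scaleR_commute intro: bounded_linear_compose[OF bounded_linear_scaleR_right])

lemma residual_properties:
  assumes P: "bounded_op UNIV UNIV P"
    and sa: "\<And>x y. cinner (P x) y = cinner x (P y)"
    and le: "\<And>x. (norm (P x))\<^sup>2 \<le> inner (P x) x"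
  shows "bounded_op UNIV UNIV (residual P n)"
    and "cinner (residual P n x) y = cinner x (residual P n y)"
    and "(norm (residual P n x))\<^sup>2 \<le> inner (residual P n x) x"
    and "inner (residual P (Suc n) x) x = inner (residual P n x) x - (norm (residual P n x))\<^sup>2"
proof -
  have *: "bounded_op UNIV UNIV (residual P n) \<and>
    (\<forall>x y. cinner (residual P n x) y = cinner x (residual P n y)) \<and>
    (\<forall>x. (norm (residual P n x))\<^sup>2 \<le> inner (residual P n x) x)" for n
  proof (induction n)
    case 0
    then show ?case
      using assms by simp
  next
    case (Suc n)
    define R where "R = residual P n"
    have R: "bounded_op UNIV UNIV R" and saR: "\<And>x y. cinner (R x) y = cinner x (R y)"
      and leR: "\<And>x. (norm (R x))\<^sup>2 \<le> inner (R x) x"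
      using Suc by (auto simp: R_def)
    have lin: "R (x - y) = R x - R y" for x y
      by (rule bounded_op_diff[OF R]) auto
    have contr: "norm (R x) \<le> norm x" for x
    proof (cases "R x = 0")
      case False
      have "norm (R x) * norm (R x) \<le> norm (R x) * norm x"
        using leR[of x] norm_cauchy_schwarz[of "R x" x] by (simp add: power2_eq_square)
      with False show ?thesis
        by simp
    qed simp
    have "(norm (R (x - R x)))\<^sup>2 \<le> inner (R (x - R x)) x" for x
    proof -
      have "inner (R (R x)) (R x) \<le> (norm (R x))\<^sup>2"
        using norm_cauchy_schwarz[of "R (R x)" "R x"] contr[of "R x"]
          mult_right_mono[OF contr[of "R x"] norm_ge_zero[of "R x"]]
        by (simp add: power2_eq_square)
      then have "0 \<le> inner (R (x - R x)) (R x)"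
        by (simp add: lin inner_diff_left power2_norm_eq_inner)
      moreover have "inner (R (x - R x)) x = inner (R (x - R x)) (x - R x) + inner (R (x - R x)) (R x)"
        by (simp add: inner_diff_right)
      ultimately show ?thesis
        using leR[of "x - R x"] by linarith
    qed
    moreover have "cinner (R (x - R x)) y = cinner x (R (y - R y))" for x y
      by (simp add: saR cinner_diff_left lin cinner_diff_right)
    moreover have "bounded_op UNIV UNIV (\<lambda>x. R (x - R x))"
      using bounded_op_compose[OF bounded_op_sub[OF bounded_op_id R] R] by (simp add: o_def)
    ultimately show ?case
      by (simp add: R_def)
  qed
  from * show "bounded_op UNIV UNIV (residual P n)"
    "cinner (residual P n x) y = cinner x (residual P n y)"
    "(norm (residual P n x))\<^sup>2 \<le> inner (residual P n x) x"
    by blast+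
  have "inner (residual P n (x - residual P n x)) x = inner (residual P n x) x - inner (residual P n (residual P n x)) x"
    using bounded_op_diff[of UNIV UNIV "residual P n"] * by (simp add: inner_diff_left)
  also have "inner (residual P n (residual P n x)) x = inner (residual P n x) (residual P n x)"
    using * self_adjoint_inner by metis
  finally show "inner (residual P (Suc n) x) x = inner (residual P n x) x - (norm (residual P n x))\<^sup>2"
    by (simp add: power2_norm_eq_inner)
qed

lemma residual_sums:
  assumes P: "bounded_op UNIV UNIV P"
    and sa: "\<And>x y. cinner (P x) y = cinner x (P y)"
    and le: "\<And>x. (norm (P x))\<^sup>2 \<le> inner (P x) x"
  shows "(\<lambda>n. (norm (residual P n x))\<^sup>2) sums inner (P x) x"
proof -
  note props = residual_properties[OF assms]
  have part: "(\<Sum>k<n. (norm (residual P k x))\<^sup>2) = inner (P x) x - inner (residual P n x) x" for n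
    by (induction n) (simp_all del: residual.simps(2) add: props(4))
  have nonneg: "0 \<le> inner (residual P n x) x" for n
    using props(3)[of n x] order_trans zero_le_power2 by blast
  have "summable (\<lambda>n. (norm (residual P n x))\<^sup>2)"
    by (rule summableI_nonneg_bounded[where x = "inner (P x) x"]) (simp_all add: part nonneg)
  then have "(\<lambda>n. sqrt ((norm (residual P n x))\<^sup>2)) \<longlonglongrightarrow> sqrt 0"
    by (intro tendsto_real_sqrt summable_LIMSEQ_zero)
  then have "(\<lambda>n. residual P n x) \<longlonglongrightarrow> 0"
    by (simp add: tendsto_norm_zero_iff)
  then have "(\<lambda>n. inner (P x) x - inner (residual P n x) x) \<longlonglongrightarrow> inner (P x) x - inner 0 x"
    by (intro tendsto_intros)
  then show ?thesis
    by (simp add: sums_def part)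
qed

lemma positive_op_factorization:
  fixes P :: "'a::chilbert_space \<Rightarrow> 'a"
  assumes P: "bounded_op UNIV UNIV P"
    and sa: "\<And>x y. cinner (P x) y = cinner x (P y)" and pos: "\<And>x. 0 \<le> inner (P x) x"
  obtains D :: "'a \<Rightarrow> 'a ell2"
  where "bounded_op UNIV UNIV D" "\<And>x. (norm (D x))\<^sup>2 = inner (P x) x"
proof -
  obtain b where b: "b > 0" "\<And>x. (norm (P x))\<^sup>2 \<le> b * inner (P x) x"
    using positive_op_sq_le[OF assms] by blast
  define P' where "P' = (\<lambda>x. (1 / b) *\<^sub>R P x)"
  have P': "bounded_op UNIV UNIV P'"
    unfolding P'_def by (rule bounded_op_scaleR[OF P])
  have sa': "cinner (P' x) y = cinner x (P' y)" for x y
    unfolding P'_def scaleC_of_real[symmetric] cinner_scaleC_left cinner_scaleC_right sa by simp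
  have le': "(norm (P' x))\<^sup>2 \<le> inner (P' x) x" for x
    using b(1) mult_left_mono[OF b(2)[of x], of "1 / b\<^sup>2"]
    by (simp add: P'_def power_mult_distrib power2_eq_square field_simps)
  note R = residual_properties[OF P' sa' le']
  have sums: "(\<lambda>n. (norm (sqrt b *\<^sub>R residual P' n x))\<^sup>2) sums inner (P x) x" for x
    using sums_mult[OF residual_sums[OF P' sa' le', of x], of b] b(1)
    by (simp add: power_mult_distrib P'_def)
  define D where "D = (\<lambda>x. Abs_ell2 (\<lambda>n. sqrt b *\<^sub>R residual P' n x))"
  have Rep: "Rep_ell2 (D x) n = sqrt b *\<^sub>R residual P' n x" for x n
    using sums[of x] by (simp add: D_def Abs_ell2_inverse sums_iff)
  have norm: "(norm (D x))\<^sup>2 = inner (P x) x" for x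
    using sums[of x] by (simp add: norm_ell2_sq Rep sums_iff)
  obtain B where B: "B > 0" "\<And>x. norm (P x) \<le> B * norm x"
    using bounded_op_pos_bound[OF P] by auto
  have "norm (D x) \<le> sqrt B * norm x" for x
  proof (rule power2_le_imp_le)
    have "(norm (D x))\<^sup>2 \<le> norm (P x) * norm x"
      unfolding norm by (rule norm_cauchy_schwarz)
    also have "\<dots> \<le> (B * norm x) * norm x"
      by (intro mult_right_mono B norm_ge_zero)
    finally show "(norm (D x))\<^sup>2 \<le> (sqrt B * norm x)\<^sup>2"
      using B(1) by (simp add: power_mult_distrib power2_eq_square[of "norm x"] mult.assoc)
  qed (use B(1) in simp)
  moreover have "D (x + y) = D x + D y" for x y
    by (rule ell2_eqI) (simp add: Rep bounded_opD(2)[OF R(1)] scaleR_add_right)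
  moreover have "D (c *\<^sub>C x) = c *\<^sub>C D x" for c x
    by (rule ell2_eqI) (simp add: Rep bounded_opD(3)[OF R(1)] scaleC_scaleR_commute)
  ultimately have "bounded_op UNIV UNIV D"
    unfolding bounded_op_def by blast
  with norm show thesis
    by (intro that)
qed

section \<open>Similarity to an isometry\<close>

text \<open>
  With \<open>X = 1 - Y\<close>, the equation \<open>X\<^sup>2 = 1 - N\<close> reads \<open>Y = (N + Y\<^sup>2) / 2\<close>. The right-hand side is a
  contraction on the self-adjoint operators \<open>Y\<close> of norm at most \<open>\<rho>\<close>.
\<close>

lemma sqrt_one_minus_exists:
  fixes N :: "'a::chilbert_space \<Rightarrow> 'a"
  assumes N: "bounded_op UNIV UNIV N"
    and sa: "\<And>x y. cinner (N x) y = cinner x (N y)"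
    and \<rho>: "\<rho> < 1" "\<And>x. norm (N x) \<le> \<rho> * norm x" "0 \<le> \<rho>"
  obtains X where "bounded_linear X" "\<And>x y. cinner (X x) y = cinner x (X y)"
    "\<And>x. X (X x) = x - N x" "\<And>x. norm (x - X x) \<le> \<rho> * norm x"
proof -
  define \<N> where "\<N> = Blinfun N"
  have \<N>: "blinfun_apply \<N> = N"
    using N by (simp add: \<N>_def bounded_op_UNIV_iff bounded_linear_Blinfun_apply)
  have norm\<N>: "norm \<N> \<le> \<rho>"
    using \<rho> by (intro norm_blinfun_bound) (auto simp: \<N>)
  define \<Y> where "\<Y> = {Y :: 'a \<Rightarrow>\<^sub>L 'a. norm Y \<le> \<rho> \<and> (\<forall>x y. cinner (blinfun_apply Y x) y = cinner x (blinfun_apply Y y))}"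
  define f where "f = (\<lambda>Y. (1 / 2) *\<^sub>R (\<N> + (Y o\<^sub>L Y)))"
  have "closed \<Y>"
    unfolding \<Y>_def
    by (intro closed_Collect_conj closed_Collect_all closed_Collect_le closed_Collect_eq
        continuous_on_cinner continuous_intros)
  then have "complete \<Y>"
    by (simp add: complete_eq_closed)
  moreover have "\<Y> \<noteq> {}"
    using \<rho>(3) by (auto simp: \<Y>_def intro!: exI[of _ 0])
  moreover have "f ` \<Y> \<subseteq> \<Y>"
  proof safe
    fix Y
    assume Y: "Y \<in> \<Y>"
    have "norm (Y o\<^sub>L Y) \<le> norm Y * norm Y"
      by (rule norm_blinfun_compose)
    also have "\<dots> \<le> \<rho> * 1"
      using Y \<rho> by (intro mult_mono) (auto simp: \<Y>_def)
    finally have "norm (f Y) \<le> \<rho>"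
      using norm_triangle_ineq[of \<N> "Y o\<^sub>L Y"] norm\<N> by (simp add: f_def)
    moreover have "cinner (blinfun_apply (f Y) x) y = cinner x (blinfun_apply (f Y) y)" for x y
      using Y by (simp add: f_def \<Y>_def blinfun.bilinear_simps \<N> scaleC_of_real[symmetric]
          cinner_scaleC_left cinner_scaleC_right cinner_add_left cinner_add_right sa del: scaleC_of_real)
    ultimately show "f Y \<in> \<Y>"
      by (simp add: \<Y>_def)
  qed
  moreover have "dist (f Y) (f Z) \<le> \<rho> * dist Y Z" if Y: "Y \<in> \<Y>" and Z: "Z \<in> \<Y>" for Y Z
  proof -
    have "f Y - f Z = (1 / 2) *\<^sub>R ((Y o\<^sub>L (Y - Z)) + ((Y - Z) o\<^sub>L Z))"
      by (rule blinfun_eqI) (simp add: f_def blinfun.bilinear_simps algebra_simps)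
    then have "dist (f Y) (f Z) = (1 / 2) * norm ((Y o\<^sub>L (Y - Z)) + ((Y - Z) o\<^sub>L Z))"
      by (simp add: dist_norm)
    also have "\<dots> \<le> (1 / 2) * (norm Y * norm (Y - Z) + norm (Y - Z) * norm Z)"
      by (intro mult_left_mono order_trans[OF norm_triangle_ineq] add_mono norm_blinfun_compose) simp
    also have "\<dots> \<le> (1 / 2) * (\<rho> * norm (Y - Z) + norm (Y - Z) * \<rho>)"
      using Y Z by (intro mult_left_mono add_mono mult_right_mono) (auto simp: \<Y>_def)
    finally show ?thesis
      by (simp add: dist_norm algebra_simps)
  qed
  ultimately obtain Y where Y: "Y \<in> \<Y>" and fixpoint: "f Y = Y"
    using Banach_fix[of \<Y> \<rho> f] \<rho> by blast
  have half: "Y x = (1 / 2) *\<^sub>R (N x + Y (Y x))" for x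
    using arg_cong[OF fixpoint, of "\<lambda>Z. blinfun_apply Z x"]
    by (simp add: f_def blinfun.bilinear_simps \<N>)
  have YY: "Y (Y x) = Y x + Y x - N x" for x
    using arg_cong[OF half[of x], of "\<lambda>z. 2 *\<^sub>R z"] by (simp add: scaleR_2 algebra_simps)
  show thesis
  proof (rule that[of "\<lambda>x. x - Y x"])
    show "bounded_linear (\<lambda>x. x - Y x)"
      by (intro bounded_linear_intros)
    show "cinner (x - Y x) y = cinner x (y - Y y)" for x y
      using Y by (simp add: \<Y>_def cinner_diff_left cinner_diff_right)
    show "x - Y x - Y (x - Y x) = x - N x" for x
      by (simp add: blinfun.bilinear_simps YY)
    show "norm (x - (x - Y x)) \<le> \<rho> * norm x" for x
      using norm_blinfun[of Y x] mult_right_mono[of "norm Y" \<rho> "norm x"] Y by (simp add: \<Y>_def)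
  qed
qed

text \<open>A preimage of \<open>y\<close> is a fixed point of the contraction \<open>x \<mapsto> x - X x + y\<close>.\<close>

lemma invertible_op_near_identity:
  fixes X :: "'a::chilbert_space \<Rightarrow> 'a"
  assumes X: "bounded_op UNIV UNIV X"
    and \<rho>: "\<rho> < 1" "0 \<le> \<rho>" "\<And>x. norm (x - X x) \<le> \<rho> * norm x"
  shows "invertible_op UNIV X"
proof -
  have diff: "X (x - y) = X x - X y" for x y
    by (rule bounded_op_diff[OF X]) auto
  have below: "(1 - \<rho>) * norm x \<le> norm (X x)" for x
    using \<rho>(3)[of x] norm_triangle_ineq[of "X x" "x - X x"] by (simp add: algebra_simps)
  have "\<exists>x. X x = y" for y
  proof -
    have "\<exists>!x. x - X x + y = x"
    proof (rule banach_fix_type[OF \<rho>(2,1)], intro allI)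
      fix u v
      show "dist (u - X u + y) (v - X v + y) \<le> \<rho> * dist u v"
        using \<rho>(3)[of "u - v"] by (simp add: dist_norm diff algebra_simps)
    qed
    then obtain x where "x - X x + y = x"
      by blast
    then have "X x = y"
      by (simp add: algebra_simps)
    then show ?thesis ..
  qed
  then have surj: "surj X"
    by (metis surjI)
  have inj: "inj X"
  proof (rule injI)
    fix x y
    assume "X x = X y"
    then have "(1 - \<rho>) * norm (x - y) \<le> 0"
      using below[of "x - y"] by (simp add: diff)
    with \<rho>(1) show "x = y"
      by (simp add: mult_le_0_iff)
  qed
  have Xinv: "X (inv X y) = y" for y
    by (rule surj_f_inv_f[OF surj])
  have "norm (inv X y) \<le> (1 / (1 - \<rho>)) * norm y" for y
    using below[of "inv X y"] \<rho>(1) by (simp add: Xinv field_simps)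
  moreover have "inv X (x + y) = inv X x + inv X y" for x y
    by (rule injD[OF inj]) (simp add: Xinv bounded_opD(2)[OF X])
  moreover have "inv X (c *\<^sub>C x) = c *\<^sub>C inv X x" for c x
    by (rule injD[OF inj]) (simp add: Xinv bounded_opD(3)[OF X])
  ultimately have "bounded_op UNIV UNIV (inv X)"
    unfolding bounded_op_def by blast
  then show ?thesis
    unfolding invertible_op_def using X by (auto simp: Xinv inv_f_f[OF inj])
qed

text \<open>
  A self-adjoint square root \<open>X\<close> of a small multiple of \<open>S\<^sup>* S\<close> satisfies
  \<open>norm (X (S z)) = norm (X z)\<close> for a quasi-isometry \<open>S\<close>, so \<open>X S X\<^sup>-\<^sup>1\<close> is an isometry.
\<close>

lemma similar_to_isometry_if_bounded_below:
  fixes S :: "'a::chilbert_space \<Rightarrow> 'a"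
  assumes S: "bounded_op UNIV UNIV S" and quasi: "\<And>x. norm (S (S x)) = norm (S x)"
    and below: "\<And>x. norm x \<le> C * norm (S x)" and C: "C > 0"
  shows "similar_to_isometry S"
proof -
  define P where "P = adj UNIV S \<circ> S"
  have P: "bounded_op UNIV UNIV P"
    unfolding P_def by (rule bounded_op_compose[OF S bounded_op_adj[OF S]])
  have form: "cinner (P x) y = cinner (S x) (S y)" for x y
    by (simp add: P_def cinner_adj_left[OF closed_subspace_UNIV S])
  have formR: "inner (P x) x = (norm (S x))\<^sup>2" for x
    using arg_cong[OF form[of x x], of Re] by (simp add: Re_cinner power2_norm_eq_inner)
  obtain B where B: "B > 0" "\<And>x. norm (P x) \<le> B * norm x"
    using bounded_op_pos_bound[OF P] by auto
  \<comment> \<open>With this \<open>t\<close> the bound \<open>1 - 2 t / C\<^sup>2 + t\<^sup>2 B\<^sup>2\<close> for the squared norm of \<open>1 - t P\<close> is below 1.\<close>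
  define t where "t = 1 / (C\<^sup>2 * B\<^sup>2)"
  have t: "t > 0" "t * (C\<^sup>2 * B\<^sup>2) = 1"
    using B(1) C by (auto simp: t_def)
  define q where "q = max 0 (1 - t / C\<^sup>2)"
  define N where "N = (\<lambda>x. x - t *\<^sub>R P x)"
  have N: "bounded_op UNIV UNIV N"
    unfolding N_def by (intro bounded_op_sub bounded_op_scaleR P bounded_op_id)
  have saN: "cinner (N x) y = cinner x (N y)" for x y
    unfolding N_def scaleC_of_real[symmetric] cinner_diff_left cinner_diff_right
      cinner_scaleC_left cinner_scaleC_right form
    using form[of y x] by (simp flip: cinner_commute) (metis cinner_commute form)
  have "(norm (N x))\<^sup>2 \<le> q * (norm x)\<^sup>2" for x
  proof -
    have "(norm (N x))\<^sup>2 = (norm x)\<^sup>2 - 2 * t * (norm (S x))\<^sup>2 + t\<^sup>2 * (norm (P x))\<^sup>2"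
      unfolding formR[symmetric] unfolding N_def power2_norm_eq_inner
      by (simp add: inner_diff_left inner_diff_right inner_commute algebra_simps power2_eq_square)
    also have "\<dots> \<le> (norm x)\<^sup>2 - 2 * t * ((norm x)\<^sup>2 / C\<^sup>2) + t\<^sup>2 * (B\<^sup>2 * (norm x)\<^sup>2)"
    proof (intro add_mono diff_mono mult_left_mono order_refl)
      show "(norm x)\<^sup>2 / C\<^sup>2 \<le> (norm (S x))\<^sup>2"
        using power_mono[OF below[of x], of 2] C by (simp add: power_mult_distrib field_simps)
      show "(norm (P x))\<^sup>2 \<le> B\<^sup>2 * (norm x)\<^sup>2"
        using power_mono[OF B(2)[of x], of 2] by (simp add: power_mult_distrib)
    qed (use t in auto)
    also have "\<dots> = (1 - t / C\<^sup>2) * (norm x)\<^sup>2"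
      using B(1) C by (simp add: t_def field_simps power2_eq_square)
    also have "\<dots> \<le> q * (norm x)\<^sup>2"
      by (intro mult_right_mono) (auto simp: q_def)
    finally show ?thesis .
  qed
  then have leN: "norm (N x) \<le> sqrt q * norm x" for x
    using real_sqrt_le_mono[of "(norm (N x))\<^sup>2" "q * (norm x)\<^sup>2"] by (simp add: real_sqrt_mult)
  have q: "0 \<le> sqrt q" "sqrt q < 1"
    using t(1) C by (auto simp: q_def max_def)
  obtain X where X: "bounded_linear X" "\<And>x y. cinner (X x) y = cinner x (X y)"
    "\<And>x. X (X x) = x - N x" "\<And>x. norm (x - X x) \<le> sqrt q * norm x"
    using sqrt_one_minus_exists[OF N saN q(2) leN q(1)] by blast
  have "X (c *\<^sub>C x) = c *\<^sub>C X x" for c x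
  proof -
    have "cinner (X (c *\<^sub>C x) - c *\<^sub>C X x) y = 0" for y
      by (simp add: cinner_diff_left cinner_scaleC_left X(2))
    then show ?thesis
      by (metis cinner_self_eq_0 right_minus_eq)
  qed
  with X(1) have Xop: "bounded_op UNIV UNIV X"
    by (simp add: bounded_op_UNIV_iff)
  have inv: "invertible_op UNIV X"
    using invertible_op_near_identity[OF Xop q(2,1) X(4)] .
  have normX: "(norm (X x))\<^sup>2 = t * (norm (S x))\<^sup>2" for x
  proof -
    have "(norm (X x))\<^sup>2 = inner (X (X x)) x"
      by (simp add: power2_norm_eq_inner self_adjoint_inner[OF X(2), of "X x" x])
    also have "X (X x) = t *\<^sub>R P x"
      by (simp add: X(3) N_def)
    finally show ?thesis
      by (simp add: formR)
  qed
  obtain Z where Z: "bounded_op UNIV UNIV Z" "\<And>x. Z (X x) = x" "\<And>x. X (Z x) = x"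
    using inv unfolding invertible_op_def by auto
  define W where "W = X \<circ> S \<circ> Z"
  have "bounded_op UNIV UNIV W"
    unfolding W_def using bounded_op_compose[OF Z(1) bounded_op_compose[OF S Xop]]
    by (simp add: comp_assoc)
  moreover have "norm (W x) = norm x" for x
  proof -
    have "(norm (W x))\<^sup>2 = (norm (X (Z x)))\<^sup>2"
      by (simp only: W_def o_def normX quasi)
    then show ?thesis
      by (simp add: Z(3))
  qed
  ultimately have "isometry_op UNIV UNIV W"
    by (simp add: isometry_op_def)
  moreover have "X \<circ> S = W \<circ> X"
    by (auto simp: W_def Z(2))
  ultimately show ?thesis
    unfolding similar_to_isometry_def using S inv by blast
qed

section \<open>Operators on square-summable sequences\<close>

lemma bounded_op_restrict:
  "bounded_op UNIV UNIV A \<Longrightarrow> A ` X \<subseteq> Y \<Longrightarrow> bounded_op X Y A"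
  unfolding bounded_op_def by blast

lemma bounded_op_zero_fun: "bounded_op UNIV UNIV (\<lambda>x. 0)"
  by (simp add: bounded_op_UNIV_iff)

lemma bounded_op_fst: "bounded_op UNIV UNIV (fst :: 'a::chilbert_space \<times> 'b::chilbert_space \<Rightarrow> 'a)"
  and bounded_op_snd: "bounded_op UNIV UNIV (snd :: 'a::chilbert_space \<times> 'b::chilbert_space \<Rightarrow> 'b)"
  by (simp_all add: bounded_op_UNIV_iff bounded_linear_fst bounded_linear_snd scaleC_prod_def)

lemma bounded_op_Pair:
  assumes "bounded_op UNIV UNIV f" "bounded_op UNIV UNIV g"
  shows "bounded_op UNIV UNIV (\<lambda>x. (f x, g x))"
  using assms by (simp add: bounded_op_UNIV_iff bounded_linear_Pair scaleC_prod_def)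

lemma bounded_op_comp:
  assumes "bounded_op UNIV UNIV f" "bounded_op UNIV UNIV g"
  shows "bounded_op UNIV UNIV (\<lambda>x. f (g x))"
  using bounded_op_compose[OF assms(2,1)] by (simp add: o_def)

definition econs :: "'a::complex_inner \<Rightarrow> 'a ell2 \<Rightarrow> 'a ell2"
  where "econs a x = Abs_ell2 (case_nat a (Rep_ell2 x))"

definition etl :: "'a::complex_inner ell2 \<Rightarrow> 'a ell2"
  where "etl x = Abs_ell2 (\<lambda>n. Rep_ell2 x (Suc n))"

lemma Rep_econs [simp]: "Rep_ell2 (econs a x) n = (case n of 0 \<Rightarrow> a | Suc k \<Rightarrow> Rep_ell2 x k)"
proof -
  have "summable (\<lambda>n. (norm (case n of 0 \<Rightarrow> a | Suc k \<Rightarrow> Rep_ell2 x k))\<^sup>2)"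
    by (subst summable_Suc_iff[symmetric]) (simp add: ell2_summable)
  then show ?thesis
    by (simp add: econs_def Abs_ell2_inverse)
qed

lemma Rep_etl [simp]: "Rep_ell2 (etl x) n = Rep_ell2 x (Suc n)"
proof -
  have "summable (\<lambda>n. (norm (Rep_ell2 x (Suc n)))\<^sup>2)"
    by (subst summable_Suc_iff) (rule ell2_summable)
  then show ?thesis
    by (simp add: etl_def Abs_ell2_inverse)
qed

lemma etl_econs [simp]: "etl (econs a x) = x"
  by (rule ell2_eqI) simp

lemma econs_eta [simp]: "econs (Rep_ell2 x 0) (etl x) = x"
  by (rule ell2_eqI) (simp split: nat.split)

lemma cinner_econs: "cinner (econs a x) (econs b y) = cinner a b + cinner x y"
  using suminf_split_head[OF ell2_summable_cinner[of "econs a x" "econs b y"]]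
  by (simp add: cinner_ell2_def)

lemma norm_econs: "(norm (econs a x))\<^sup>2 = (norm a)\<^sup>2 + (norm x)\<^sup>2"
proof -
  have "complex_of_real ((norm (econs a x))\<^sup>2) = complex_of_real ((norm a)\<^sup>2 + (norm x)\<^sup>2)"
    unfolding of_real_add cinner_self[symmetric] by (rule cinner_econs)
  then show ?thesis
    by (rule of_real_eq_iff[THEN iffD1])
qed

lemma econs_add: "econs (a + b) (x + y) = econs a x + econs b y"
  by (rule ell2_eqI) (simp split: nat.split)

lemma econs_scaleC: "econs (c *\<^sub>C a) (c *\<^sub>C x) = c *\<^sub>C econs a x"
  by (rule ell2_eqI) (simp split: nat.split)

lemma econs_zero [simp]: "econs 0 0 = 0"
  by (rule ell2_eqI) (simp split: nat.split)

lemma bounded_op_econs: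
  assumes f: "bounded_op UNIV UNIV f" and g: "bounded_op UNIV UNIV g"
  shows "bounded_op UNIV UNIV (\<lambda>x. econs (f x) (g x))"
proof -
  obtain B where B: "\<And>x. norm (f x) \<le> B * norm x"
    using bounded_op_pos_bound[OF f] by auto
  obtain C where C: "\<And>x. norm (g x) \<le> C * norm x"
    using bounded_op_pos_bound[OF g] by auto
  have "norm (econs (f x) (g x)) \<le> (B + C) * norm x" for x
  proof -
    have "norm (econs (f x) (g x)) \<le> norm (f x) + norm (g x)"
      by (rule power2_le_imp_le) (simp_all add: norm_econs power2_sum)
    with B[of x] C[of x] show ?thesis
      by (simp add: distrib_right)
  qed
  moreover have "econs (f (x + y)) (g (x + y)) = econs (f x) (g x) + econs (f y) (g y)" for x y
    by (simp add: bounded_opD(2)[OF f] bounded_opD(2)[OF g] econs_add)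
  moreover have "econs (f (c *\<^sub>C x)) (g (c *\<^sub>C x)) = c *\<^sub>C econs (f x) (g x)" for c x
    by (simp add: bounded_opD(3)[OF f] bounded_opD(3)[OF g] econs_scaleC)
  ultimately show ?thesis
    unfolding bounded_op_def by blast
qed

lemma bounded_op_etl: "bounded_op UNIV UNIV (etl :: 'a::chilbert_space ell2 \<Rightarrow> 'a ell2)"
proof -
  have "norm (etl x) \<le> 1 * norm x" for x :: "'a ell2"
    by (rule power2_le_imp_le) (use norm_econs[of "Rep_ell2 x 0" "etl x"] in auto)
  moreover have "etl (x + y) = etl x + etl y" "etl (c *\<^sub>C x) = c *\<^sub>C etl x" for x y :: "'a ell2" and c
    by (rule ell2_eqI, simp)+
  ultimately show ?thesis
    unfolding bounded_op_def by blast
qed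

lemma bounded_op_Rep: "bounded_op UNIV UNIV (\<lambda>x :: 'a::chilbert_space ell2. Rep_ell2 x n)"
proof -
  have "\<exists>B. \<forall>x :: 'a ell2. norm (Rep_ell2 x n) \<le> B * norm x"
    by (rule exI[of _ 1]) (simp add: norm_Rep_ell2_le)
  then show ?thesis
    by (simp add: bounded_op_def)
qed

definition emap :: "('a::complex_inner \<Rightarrow> 'b::complex_inner) \<Rightarrow> 'a ell2 \<Rightarrow> 'b ell2"
  where "emap f x = Abs_ell2 (\<lambda>n. f (Rep_ell2 x n))"

lemma
  assumes f: "bounded_op UNIV UNIV f"
  shows Rep_emap: "Rep_ell2 (emap f x) n = f (Rep_ell2 x n)"
    and bounded_op_emap: "bounded_op UNIV UNIV (emap f)"
proof -
  obtain B where B: "B > 0" "\<And>x. norm (f x) \<le> B * norm x"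
    using bounded_op_pos_bound[OF f] by auto
  have le: "(norm (f (Rep_ell2 x n)))\<^sup>2 \<le> B\<^sup>2 * (norm (Rep_ell2 x n))\<^sup>2" for x n
    using power_mono[OF B(2)[of "Rep_ell2 x n"], of 2] by (simp add: power_mult_distrib)
  have majorant: "summable (\<lambda>n. B\<^sup>2 * (norm (Rep_ell2 x n))\<^sup>2)" for x :: "'a ell2"
    by (intro summable_mult ell2_summable)
  have summable: "summable (\<lambda>n. (norm (f (Rep_ell2 x n)))\<^sup>2)" for x
    by (rule summable_comparison_test'[OF majorant[of x]]) (simp add: le)
  then have Rep: "Rep_ell2 (emap f x) n = f (Rep_ell2 x n)" for x n
    by (simp add: emap_def Abs_ell2_inverse)
  then show "Rep_ell2 (emap f x) n = f (Rep_ell2 x n)" .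
  have "norm (emap f x) \<le> B * norm x" for x
  proof (rule power2_le_imp_le)
    have "(norm (emap f x))\<^sup>2 \<le> (\<Sum>n. B\<^sup>2 * (norm (Rep_ell2 x n))\<^sup>2)"
      unfolding norm_ell2_sq Rep by (rule suminf_le[OF le summable majorant])
    then show "(norm (emap f x))\<^sup>2 \<le> (B * norm x)\<^sup>2"
      by (simp add: norm_ell2_sq power_mult_distrib suminf_mult ell2_summable)
  qed (use B(1) in simp)
  moreover have "emap f (x + y) = emap f x + emap f y" for x y
    by (rule ell2_eqI) (simp add: Rep bounded_opD(2)[OF f])
  moreover have "emap f (c *\<^sub>C x) = c *\<^sub>C emap f x" for c x
    by (rule ell2_eqI) (simp add: Rep bounded_opD(3)[OF f])
  ultimately show "bounded_op UNIV UNIV (emap f)"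
    unfolding bounded_op_def by blast
qed

lemma norm_emap_isometry:
  assumes "isometry_op UNIV UNIV f"
  shows "norm (emap f x) = norm x"
proof (rule power2_eq_imp_eq)
  show "(norm (emap f x))\<^sup>2 = (norm x)\<^sup>2"
    unfolding norm_ell2_sq Rep_emap[OF isometry_opD(1)[OF assms]]
    by (simp add: isometry_opD(2)[OF assms])
qed simp_all

lemma cinner_emap:
  assumes f: "bounded_op UNIV UNIV f" and sa: "\<And>x y. cinner (f x) y = cinner x (f y)"
  shows "cinner (emap f x) y = cinner x (emap f y)"
  by (simp add: cinner_ell2_def Rep_emap[OF f] sa)

section \<open>Unitary operators\<close>

definition unitary_op :: "('a::chilbert_space \<Rightarrow> 'b::chilbert_space) \<Rightarrow> bool"
  where "unitary_op U \<longleftrightarrow> isometry_op UNIV UNIV U \<and> surj U"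

lemma unitary_op_compose: "unitary_op U \<Longrightarrow> unitary_op W \<Longrightarrow> unitary_op (U \<circ> W)"
  unfolding unitary_op_def isometry_op_def
  using bounded_op_compose[of UNIV UNIV W UNIV U] comp_surj[of W U] by simp

lemma unitary_op_inv:
  assumes "unitary_op U"
  shows "unitary_op (inv U)" "U (inv U x) = x" "inv U (U y) = y"
proof -
  have U: "bounded_op UNIV UNIV U" "\<And>x. norm (U x) = norm x" and inj: "inj U" and surj: "surj U"
    using assms isometry_inj by (auto simp: unitary_op_def isometry_op_def)
  show Uinv: "U (inv U x) = x" for x
    by (rule surj_f_inv_f[OF surj])
  show invU: "inv U (U y) = y" for y
    by (rule inv_f_f[OF inj])
  have norm: "norm (inv U x) = norm x" for x
    using U(2)[of "inv U x"] by (simp add: Uinv)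
  moreover have "inv U (x + y) = inv U x + inv U y" for x y
    by (rule injD[OF inj]) (simp add: Uinv bounded_opD(2)[OF U(1)])
  moreover have "inv U (c *\<^sub>C x) = c *\<^sub>C inv U x" for c x
    by (rule injD[OF inj]) (simp add: Uinv bounded_opD(3)[OF U(1)])
  ultimately show "unitary_op (inv U)"
    unfolding unitary_op_def isometry_op_def bounded_op_def
    using inj by (auto simp: inj_imp_surj_inv intro!: exI[of _ 1])
qed

lemma unitary_op_econs:
  "unitary_op (\<lambda>p :: 'a::chilbert_space \<times> 'a ell2. econs (fst p) (snd p))"
proof -
  have "norm (econs a x) = norm (a, x)" for a :: 'a and x
    by (rule power2_eq_imp_eq) (simp_all add: norm_econs norm_Pair)
  moreover have "surj (\<lambda>p :: 'a \<times> 'a ell2. econs (fst p) (snd p))"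
    by (rule surjI[of _ "\<lambda>x. (Rep_ell2 x 0, etl x)"]) simp
  ultimately show ?thesis
    by (simp add: unitary_op_def isometry_op_def bounded_op_econs bounded_op_fst bounded_op_snd)
qed

definition flatten :: "'a::complex_inner ell2 ell2 \<Rightarrow> 'a ell2"
  where "flatten x = Abs_ell2 (\<lambda>n. case prod_decode n of (i, j) \<Rightarrow> Rep_ell2 (Rep_ell2 x i) j)"

lemma suminf_ennreal_norm_ell2: "(\<Sum>n. ennreal ((norm (Rep_ell2 x n))\<^sup>2)) = ennreal ((norm x)\<^sup>2)"
  by (simp add: norm_ell2_sq suminf_ennreal2 ell2_summable)

lemma
  fixes x :: "'a::complex_inner ell2 ell2"
  shows Rep_flatten: "Rep_ell2 (flatten x) n = (case prod_decode n of (i, j) \<Rightarrow> Rep_ell2 (Rep_ell2 x i) j)"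
    and norm_flatten: "norm (flatten x) = norm x"
proof -
  define f where "f = (\<lambda>(i, j). ennreal ((norm (Rep_ell2 (Rep_ell2 x i) j))\<^sup>2))"
  have "(\<Sum>n. f (prod_decode n)) = (\<Sum>i. ennreal ((norm (Rep_ell2 x i))\<^sup>2))"
    by (rule suminf_ennreal_2dimen) (simp add: f_def suminf_ennreal_norm_ell2)
  then have total: "(\<Sum>n. f (prod_decode n)) = ennreal ((norm x)\<^sup>2)"
    by (simp add: suminf_ennreal_norm_ell2)
  have f: "f (prod_decode n) =
      ennreal ((norm (case prod_decode n of (i, j) \<Rightarrow> Rep_ell2 (Rep_ell2 x i) j))\<^sup>2)" for n
    by (simp add: f_def split: prod.split)
  have "summable (\<lambda>n. (norm (case prod_decode n of (i, j) \<Rightarrow> Rep_ell2 (Rep_ell2 x i) j))\<^sup>2)"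
    using total unfolding f by (intro summable_suminf_not_top) auto
  then have Rep: "Rep_ell2 (flatten x) n = (case prod_decode n of (i, j) \<Rightarrow> Rep_ell2 (Rep_ell2 x i) j)" for n
    by (simp add: flatten_def Abs_ell2_inverse)
  then show "Rep_ell2 (flatten x) n = (case prod_decode n of (i, j) \<Rightarrow> Rep_ell2 (Rep_ell2 x i) j)" .
  have "ennreal ((norm (flatten x))\<^sup>2) = ennreal ((norm x)\<^sup>2)"
    using total unfolding f Rep[symmetric] suminf_ennreal_norm_ell2 .
  then show "norm (flatten x) = norm x"
    by simp
qed

lemma surj_flatten: "surj (flatten :: 'a::complex_inner ell2 ell2 \<Rightarrow> 'a ell2)"
  unfolding surj_def
proof
  fix y :: "'a ell2"
  define g where "g = (\<lambda>i. \<Sum>j. ennreal ((norm (Rep_ell2 y (prod_encode (i, j))))\<^sup>2))"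
  have "(\<Sum>n. ennreal ((norm (Rep_ell2 y (prod_encode (prod_decode n))))\<^sup>2)) = suminf g"
    by (rule suminf_ennreal_2dimen[where f = "\<lambda>p. ennreal ((norm (Rep_ell2 y (prod_encode p)))\<^sup>2)"])
      (simp add: g_def)
  then have total: "suminf g = ennreal ((norm y)\<^sup>2)"
    by (simp add: suminf_ennreal_norm_ell2)
  have "g i \<noteq> top" for i
    using sum_le_suminf[of g "{i}"] total by (auto simp: top_unique)
  then have "summable (\<lambda>j. (norm (Rep_ell2 y (prod_encode (i, j))))\<^sup>2)" for i
    unfolding g_def by (intro summable_suminf_not_top) auto
  then have row: "Rep_ell2 (Abs_ell2 (\<lambda>j. Rep_ell2 y (prod_encode (i, j)))) =
      (\<lambda>j. Rep_ell2 y (prod_encode (i, j)))" for i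
    by (simp add: Abs_ell2_inverse)
  define x where "x = (\<lambda>i. Abs_ell2 (\<lambda>j. Rep_ell2 y (prod_encode (i, j))))"
  have g: "g i = ennreal ((norm (x i))\<^sup>2)" for i
    unfolding g_def suminf_ennreal_norm_ell2[symmetric] by (simp add: x_def row)
  have "summable (\<lambda>i. (norm (x i))\<^sup>2)"
    using total unfolding g by (intro summable_suminf_not_top) auto
  then have "Rep_ell2 (Abs_ell2 x) = x"
    by (simp add: Abs_ell2_inverse)
  then have "y = flatten (Abs_ell2 x)"
    by (intro ell2_eqI) (simp add: Rep_flatten x_def row case_prod_unfold)
  then show "\<exists>x. y = flatten x" ..
qed

lemma unitary_op_flatten: "unitary_op (flatten :: 'a::chilbert_space ell2 ell2 \<Rightarrow> 'a ell2)"
proof -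
  have "flatten (x + y) = flatten x + flatten y" "flatten (c *\<^sub>C x) = c *\<^sub>C flatten x"
    for x y :: "'a ell2 ell2" and c
    by (rule ell2_eqI, simp add: Rep_flatten split: prod.split)+
  then have "bounded_op UNIV UNIV (flatten :: 'a ell2 ell2 \<Rightarrow> 'a ell2)"
    unfolding bounded_op_def by (auto simp: norm_flatten intro!: exI[of _ 1])
  then show ?thesis
    by (simp add: unitary_op_def isometry_op_def norm_flatten surj_flatten)
qed

section \<open>A quasi-isometric lifting\<close>

text \<open>
  An invertible positive operator is bounded below by a positive multiple of the identity, so a
  positive multiple of it dominates the identity.
\<close>

lemma similar_to_contraction_witness:
  assumes "similar_to_contraction T"
  obtains A where "bounded_op UNIV UNIV A" "\<And>x y. cinner (A x) y = cinner x (A y)"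
    "\<And>x. (norm x)\<^sup>2 \<le> inner (A x) x" "\<And>x. inner (A (T x)) (T x) \<le> inner (A x) x"
proof -
  have T: "bounded_op UNIV UNIV T"
    using assms by (simp add: similar_to_contraction_def)
  obtain A where inv: "invertible_op UNIV A" and pos: "op_le (\<lambda>_. 0) A"
    and contr: "op_le (adj UNIV T \<circ> A \<circ> T) A"
    using assms by (auto simp: similar_to_contraction_def)
  obtain R where A: "bounded_op UNIV UNIV A" and R: "bounded_op UNIV UNIV R" "\<And>x. R (A x) = x"
    using inv unfolding invertible_op_def by auto
  have nonneg: "cinner (A x) x \<in> \<real>\<^sub>\<ge>\<^sub>0" for x
    using pos by (simp add: op_le_def)
  note sa = self_adjoint_if_nonneg[OF A nonneg]
  have posR: "0 \<le> inner (A x) x" for x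
    using nonneg[of x] by (simp add: complex_nonneg_Reals_iff flip: Re_cinner)
  have contrR: "inner (A (T x)) (T x) \<le> inner (A x) x" for x
  proof -
    have "0 \<le> Re (cinner (A x - adj UNIV T (A (T x))) x)"
      using contr by (simp add: op_le_def complex_nonneg_Reals_iff)
    then show ?thesis
      by (simp add: cinner_diff_left cinner_adj_left[OF closed_subspace_UNIV T] Re_cinner)
  qed
  obtain b where b: "b > 0" "\<And>x. (norm (A x))\<^sup>2 \<le> b * inner (A x) x"
    by (rule positive_op_sq_le[OF A sa posR], rule that)
  obtain \<beta> where \<beta>: "\<beta> > 0" "\<And>x. norm (R x) \<le> \<beta> * norm x"
    using bounded_op_pos_bound[OF R(1)] by auto
  define s where "s = \<beta>\<^sup>2 * b"
  have s: "s > 0"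
    using b \<beta> by (simp add: s_def)
  show thesis
  proof (rule that[of "\<lambda>x. s *\<^sub>R A x"])
    show "bounded_op UNIV UNIV (\<lambda>x. s *\<^sub>R A x)"
      by (rule bounded_op_scaleR[OF A])
    show "cinner (s *\<^sub>R A x) y = cinner x (s *\<^sub>R A y)" for x y
      unfolding scaleC_of_real[symmetric] cinner_scaleC_left cinner_scaleC_right
      by (simp add: sa[of x y])
    show "inner (s *\<^sub>R A (T x)) (T x) \<le> inner (s *\<^sub>R A x) x" for x
      using s contrR[of x] by simp
    show "(norm x)\<^sup>2 \<le> inner (s *\<^sub>R A x) x" for x
    proof -
      have "norm x \<le> \<beta> * norm (A x)"
        using \<beta>(2)[of "A x"] unfolding R(2) .
      then have "(norm x)\<^sup>2 \<le> (\<beta> * norm (A x))\<^sup>2"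
        by (rule power_mono) (rule norm_ge_zero)
      also have "\<dots> \<le> \<beta>\<^sup>2 * (b * inner (A x) x)"
        unfolding power_mult_distrib by (intro mult_left_mono b zero_le_power2)
      finally show ?thesis
        by (simp add: s_def)
    qed
  qed
qed

text \<open>
  Write \<open>q h = inner (A h) h\<close>. The lifting sends a sequence with first entry \<open>h\<close> to one with entries
  \<open>T h\<close>, \<open>D\<^sub>2 (T h)\<close>, \<open>D\<^sub>1 h\<close>, where \<open>D\<^sub>1\<close> and \<open>D\<^sub>2\<close> are factors of \<open>A - T\<^sup>* A T\<close> and \<open>A - 1\<close>. The
  squared norms of these entries add up to
  \<open>(norm (T h))\<^sup>2 + (q (T h) - (norm (T h))\<^sup>2) + (q h - q (T h)) = q h\<close>. In the second step the new first
  entry contributes \<open>q (T h)\<close>, the entry \<open>D\<^sub>2 (T h)\<close> is discarded and \<open>D\<^sub>1 h\<close> is shifted, which gives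
  \<open>q (T h) + (q h - q (T h)) = q h\<close> again. Entries from the third on are merely shifted.
\<close>

lemma quasi_isometric_lifting_exists:
  fixes T :: "'h::chilbert_space \<Rightarrow> 'h"
  assumes "similar_to_contraction T"
  obtains J :: "'h \<Rightarrow> ('h \<times> complex) ell2 ell2" and Q
  where "lifting J UNIV Q T" "quasi_isometry UNIV Q"
proof -
  have T: "bounded_op UNIV UNIV T"
    using assms by (simp add: similar_to_contraction_def)
  obtain A where A: "bounded_op UNIV UNIV A" and sa: "\<And>x y. cinner (A x) y = cinner x (A y)"
    and ge: "\<And>x. (norm x)\<^sup>2 \<le> inner (A x) x" and contr: "\<And>x. inner (A (T x)) (T x) \<le> inner (A x) x"
    using similar_to_contraction_witness[OF assms] by blast
  note cadj = cinner_adj_left[OF closed_subspace_UNIV T UNIV_I]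
    cinner_adj_right[OF closed_subspace_UNIV T UNIV_I]
  define P1 where "P1 = (\<lambda>x. A x - adj UNIV T (A (T x)))"
  have P1: "bounded_op UNIV UNIV P1"
    unfolding P1_def
    by (intro bounded_op_sub A bounded_op_comp[OF bounded_op_adj[OF T]] bounded_op_comp[OF A T])
  have saP1: "cinner (P1 x) y = cinner x (P1 y)" for x y
    by (simp add: P1_def cinner_diff_left cinner_diff_right cadj sa)
  have formP1: "inner (P1 x) x = inner (A x) x - inner (A (T x)) (T x)" for x
    by (simp add: P1_def cinner_diff_left cadj flip: Re_cinner)
  obtain D1 :: "'h \<Rightarrow> 'h ell2" where D1: "bounded_op UNIV UNIV D1"
    "\<And>x. (norm (D1 x))\<^sup>2 = inner (A x) x - inner (A (T x)) (T x)"
    using positive_op_factorization[OF P1 saP1] contr formP1 by (metis diff_ge_0_iff_ge)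
  define P2 where "P2 = (\<lambda>x. A x - x)"
  have P2: "bounded_op UNIV UNIV P2"
    unfolding P2_def by (intro bounded_op_sub A bounded_op_id)
  have saP2: "cinner (P2 x) y = cinner x (P2 y)" for x y
    by (simp add: P2_def cinner_diff_left cinner_diff_right sa)
  have formP2: "inner (P2 x) x = inner (A x) x - (norm x)\<^sup>2" for x
    by (simp add: P2_def inner_diff_left power2_norm_eq_inner)
  obtain D2 :: "'h \<Rightarrow> 'h ell2" where D2: "bounded_op UNIV UNIV D2"
    "\<And>x. (norm (D2 x))\<^sup>2 = inner (A x) x - (norm x)\<^sup>2"
    using positive_op_factorization[OF P2 saP2] ge formP2 by (metis diff_ge_0_iff_ge)
  define \<iota> where "\<iota> = (\<lambda>h :: 'h. (h, 0 :: complex))"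
  have \<iota>: "isometry_op UNIV UNIV \<iota>"
    unfolding isometry_op_def \<iota>_def
    by (simp add: bounded_op_Pair bounded_op_zero_fun norm_Pair)
  note \<iota>b = isometry_opD(1)[OF \<iota>]
  define J where "J = (\<lambda>h. econs (econs (\<iota> h) 0) (0 :: ('h \<times> complex) ell2 ell2))"
  have Jb: "bounded_op UNIV UNIV J"
    unfolding J_def by (intro bounded_op_econs bounded_op_zero_fun \<iota>b)
  have normJ: "norm (J h) = norm h" for h
    by (rule power2_eq_imp_eq) (simp_all add: J_def norm_econs isometry_opD(2)[OF \<iota>])
  have J: "isometry_op UNIV UNIV J"
    using Jb normJ by (simp add: isometry_op_def)
  define hd where "hd = (\<lambda>x :: ('h \<times> complex) ell2 ell2. fst (Rep_ell2 (Rep_ell2 x 0) 0))"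
  have hd: "bounded_op UNIV UNIV hd"
    unfolding hd_def
    by (intro bounded_op_comp[OF bounded_op_fst] bounded_op_comp[OF bounded_op_Rep] bounded_op_Rep)
  have proj_J: "proj_onto J x = hd x" for x
  proof (rule proj_onto_eqI[OF J])
    fix h'
    have "x - J (hd x) = econs (econs (Rep_ell2 (Rep_ell2 x 0) 0 - \<iota> (hd x)) (etl (Rep_ell2 x 0))) (etl x)"
      by (intro ell2_eqI) (simp add: J_def split: nat.split)
    then show "cinner (x - J (hd x)) (J h') = 0"
      by (simp add: J_def cinner_econs \<iota>_def hd_def cinner_prod_def)
  qed
  define Q where "Q = (\<lambda>x. econs (econs (\<iota> (T (hd x))) 0)
    (econs (emap \<iota> (D2 (T (hd x)))) (econs (emap \<iota> (D1 (hd x))) (etl (etl x)))))"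
  have Q: "bounded_op UNIV UNIV Q"
    unfolding Q_def
    by (intro bounded_op_econs bounded_op_zero_fun bounded_op_comp[OF \<iota>b] bounded_op_comp[OF T] hd
        bounded_op_comp[OF bounded_op_emap[OF \<iota>b]] bounded_op_comp[OF D1(1)] bounded_op_comp[OF D2(1)]
        bounded_op_comp[OF bounded_op_etl] bounded_op_etl)
  have hdQ: "hd (Q x) = T (hd x)" for x
    by (simp add: hd_def Q_def \<iota>_def)
  have normQ: "(norm (Q x))\<^sup>2 = inner (A (hd x)) (hd x) + (norm (etl (etl x)))\<^sup>2" for x
    by (simp add: Q_def norm_econs norm_emap_isometry[OF \<iota>] D1 D2 isometry_opD(2)[OF \<iota>])
  have tailQ: "(norm (etl (etl (Q x))))\<^sup>2 =
      inner (A (hd x)) (hd x) - inner (A (T (hd x))) (T (hd x)) + (norm (etl (etl x)))\<^sup>2" for x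
    by (simp add: Q_def norm_econs norm_emap_isometry[OF \<iota>] D1)
  have "(norm (Q (Q x)))\<^sup>2 = (norm (Q x))\<^sup>2" for x
    unfolding normQ[of "Q x"] hdQ tailQ by (simp add: normQ)
  then have "quasi_isometry UNIV Q"
    using Q by (simp add: quasi_isometry_iff)
  moreover have "lifting J UNIV Q T"
    using J Q by (simp add: lifting_def proj_J hdQ)
  ultimately show thesis
    by (rule that[rotated])
qed

section \<open>Extending a quasi-isometry by an isometry\<close>

lemma closed_subspace_closure_range:
  assumes Q: "bounded_op UNIV UNIV Q"
  shows "closed_subspace (closure (range Q))"
proof -
  have add: "x + y \<in> closure (range Q)" if "x \<in> closure (range Q)" "y \<in> closure (range Q)" for x y
  proof -
    have "(x, y) \<in> closure (range Q \<times> range Q)"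
      using that by (simp add: closure_Times)
    then have "x + y \<in> (\<lambda>p. fst p + snd p) ` closure (range Q \<times> range Q)"
      by (rule rev_image_eqI) simp
    also have "\<dots> \<subseteq> closure ((\<lambda>p. fst p + snd p) ` (range Q \<times> range Q))"
      by (intro closure_bounded_linear_image_subset bounded_linear_intros)
    also have "\<dots> \<subseteq> closure (range Q)"
      by (rule closure_mono) (auto simp flip: bounded_opD(2)[OF Q])
    finally show ?thesis .
  qed
  have scale: "c *\<^sub>C x \<in> closure (range Q)" if "x \<in> closure (range Q)" for c x
  proof -
    have "bounded_linear (\<lambda>x :: 'b. c *\<^sub>C x)"
      by (rule bounded_linear_intro[of _ "cmod c"])
        (simp_all add: scaleC_add_right scaleC_scaleR_commute norm_scaleC)
    then have "(*\<^sub>C) c ` closure (range Q) \<subseteq> closure ((*\<^sub>C) c ` range Q)"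
      by (rule closure_bounded_linear_image_subset)
    also have "\<dots> \<subseteq> closure (range Q)"
      by (rule closure_mono) (auto simp flip: bounded_opD(3)[OF Q])
    finally show ?thesis
      using that by (rule image_subset_iff[THEN iffD1, THEN bspec])
  qed
  have "Q 0 \<in> closure (range Q)"
    by (rule subsetD[OF closure_subset]) (rule rangeI)
  then have "0 \<in> closure (range Q)"
    by (simp add: bounded_op_zero[OF Q])
  with add scale show ?thesis
    by (simp add: closed_subspace_def)
qed

lemma closed_isometry_image:
  assumes i: "isometry_op UNIV UNIV i" and X: "closed_subspace X"
  shows "closed (i ` X)"
proof -
  have "complete (i ` X)"
  proof (rule complete_isometric_image[of 1])
    show "subspace X"
      using closed_subspaceD[OF X] by (simp add: subspace_def)
    show "bounded_linear i"
      using isometry_opD(1)[OF i] by (simp add: bounded_op_UNIV_iff)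
    show "complete X"
      using closed_subspaceD(4)[OF X] by (simp add: complete_eq_closed)
  qed (simp_all add: isometry_opD(2)[OF i])
  then show ?thesis
    by (rule complete_imp_closed)
qed

lemma bounded_op_proj:
  assumes R: "closed_subspace R"
  shows "bounded_op UNIV UNIV (proj R)"
proof -
  have "norm (proj R x) \<le> 1 * norm x" for x
  proof (rule power2_le_imp_le)
    have "cinner (proj R x) (x - proj R x) = 0"
      using proj_orth[OF R proj_in[OF R]] by (simp add: cinner_eq_0_commute)
    from norm_add_sq_orth[OF this] show "(norm (proj R x))\<^sup>2 \<le> (1 * norm x)\<^sup>2"
      by simp
  qed simp
  moreover have "proj R (x + y) = proj R x + proj R y" for x y
  proof (rule proj_eqI[OF R])
    show "cinner (x + y - (proj R x + proj R y)) z = 0" if "z \<in> R" for z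
      using proj_orth[OF R that, of x] proj_orth[OF R that, of y]
      by (simp add: cinner_diff_left cinner_add_left)
  qed (intro closed_subspaceD[OF R] proj_in[OF R])
  moreover have "proj R (c *\<^sub>C x) = c *\<^sub>C proj R x" for c x
  proof (rule proj_eqI[OF R])
    show "cinner (c *\<^sub>C x - c *\<^sub>C proj R x) z = 0" if "z \<in> R" for z
      using proj_orth[OF R that, of x] by (simp add: cinner_diff_left cinner_scaleC_left)
  qed (intro closed_subspaceD[OF R] proj_in[OF R])
  ultimately show ?thesis
    unfolding bounded_op_def by blast
qed

text \<open>
  For a closed subspace \<open>R\<close>, the operator \<open>hotel R\<close> on sequences leaves the components in \<open>R\<close> in place
  and shifts the components orthogonal to \<open>R\<close>, as in Hilbert's hotel. It is an isometry, and the
  orthogonal complement of its range consists of the sequences that are supported on the first entry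
  and have their value there orthogonal to \<open>R\<close>.
\<close>

definition hotel :: "'a::chilbert_space set \<Rightarrow> 'a ell2 \<Rightarrow> 'a ell2"
  where "hotel R x = emap (proj R) x + econs 0 (emap (\<lambda>a. a - proj R a) x)"

context
  fixes R :: "'a::chilbert_space set"
  assumes R: "closed_subspace R"
begin

lemma bounded_op_coproj: "bounded_op UNIV UNIV (\<lambda>a. a - proj R a)"
  by (intro bounded_op_sub bounded_op_id bounded_op_proj R)

lemma proj_proj: "proj R (proj R a) = proj R a"
  by (simp add: proj_same_iff R proj_in)

lemma proj_coproj: "proj R (a - proj R a) = 0"
  using bounded_op_diff[OF bounded_op_proj[OF R], of a "proj R a"] by (simp add: proj_proj)

lemma cinner_proj: "cinner (proj R a) b = cinner a (proj R b)"
proof -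
  have "cinner (proj R a) (b - proj R b) = 0" "cinner (a - proj R a) (proj R b) = 0"
    using proj_orth[OF R proj_in[OF R]] by (simp_all add: cinner_eq_0_commute)
  then show ?thesis
    by (simp add: cinner_diff_left cinner_diff_right)
qed

lemma cinner_coproj: "cinner (a - proj R a) b = cinner a (b - proj R b)"
  by (simp add: cinner_diff_left cinner_diff_right cinner_proj)

lemma bounded_op_hotel: "bounded_op UNIV UNIV (hotel R)"
  unfolding hotel_def[abs_def]
  by (intro bounded_op_add bounded_op_econs bounded_op_zero_fun bounded_op_emap bounded_op_proj R
      bounded_op_coproj)

lemma norm_hotel: "norm (hotel R x) = norm x"
proof (rule power2_eq_imp_eq)
  let ?p = "emap (proj R)" and ?e = "emap (\<lambda>a. a - proj R a)"
  note Rep = Rep_emap[OF bounded_op_proj[OF R]] Rep_emap[OF bounded_op_coproj]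
  note sa = cinner_emap[OF bounded_op_proj[OF R] cinner_proj]
  have "?p (econs 0 (?e x)) = 0" "?p (?e x) = 0"
    using bounded_op_zero[OF bounded_op_proj[OF R]]
    by (intro ell2_eqI, simp add: Rep proj_coproj split: nat.split)+
  then have orth: "cinner (?p x) (econs 0 (?e x)) = 0" "cinner (?p x) (?e x) = 0"
    by (simp_all add: sa)
  have "?p x + ?e x = x"
    by (rule ell2_eqI) (simp add: Rep)
  then show "(norm (hotel R x))\<^sup>2 = (norm x)\<^sup>2"
    using norm_add_sq_orth[OF orth(1)] norm_add_sq_orth[OF orth(2)]
    by (simp add: hotel_def norm_econs)
qed simp_all

text \<open>The vector on the right is the image of \<open>y\<close> under the adjoint of \<open>hotel R\<close>.\<close>

lemma cinner_hotel:
  "cinner (hotel R x) y = cinner x (emap (proj R) y + emap (\<lambda>a. a - proj R a) (etl y))"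
proof -
  have "cinner (econs 0 z) y = cinner z (etl y)" for z
    using cinner_econs[of 0 z "Rep_ell2 y 0" "etl y"] by simp
  then show ?thesis
    by (simp add: hotel_def cinner_add_left cinner_add_right
        cinner_emap[OF bounded_op_proj[OF R] cinner_proj]
        cinner_emap[OF bounded_op_coproj cinner_coproj])
qed

lemma orth_range_hotel_iff:
  "(\<forall>x. cinner (hotel R x) y = 0) \<longleftrightarrow> (\<exists>a. y = econs (a - proj R a) 0)"
proof
  note Rep = Rep_emap[OF bounded_op_proj[OF R]] Rep_emap[OF bounded_op_coproj]
  assume "\<forall>x. cinner (hotel R x) y = 0"
  then have "cinner (emap (proj R) y + emap (\<lambda>a. a - proj R a) (etl y))
      (emap (proj R) y + emap (\<lambda>a. a - proj R a) (etl y)) = 0"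
    unfolding cinner_hotel by (rule spec)
  then have "emap (proj R) y + emap (\<lambda>a. a - proj R a) (etl y) = 0"
    by (rule cinner_self_eq_0[THEN iffD1])
  from arg_cong[OF this, of Rep_ell2]
  have sum: "proj R (Rep_ell2 y n) + (Rep_ell2 y (Suc n) - proj R (Rep_ell2 y (Suc n))) = 0" for n
    by (simp add: fun_eq_iff Rep)
  \<comment> \<open>The two summands lie in \<open>R\<close> and in its orthogonal complement.\<close>
  have p: "proj R (Rep_ell2 y n) = 0" for n
    using arg_cong[OF sum[of n], of "proj R"] bounded_op_zero[OF bounded_op_proj[OF R]]
    by (simp add: bounded_opD(2)[OF bounded_op_proj[OF R]] proj_proj proj_coproj)
  then have "Rep_ell2 y (Suc n) = 0" for n
    using sum[of n] by simp
  then have "y = econs (Rep_ell2 y 0 - proj R (Rep_ell2 y 0)) 0"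
    by (intro ell2_eqI) (simp add: p split: nat.split)
  then show "\<exists>a. y = econs (a - proj R a) 0" ..
next
  note Rep = Rep_emap[OF bounded_op_proj[OF R]] Rep_emap[OF bounded_op_coproj]
  assume "\<exists>a. y = econs (a - proj R a) 0"
  then have "emap (proj R) y + emap (\<lambda>a. a - proj R a) (etl y) = 0"
    using bounded_op_zero[OF bounded_op_proj[OF R]]
    by (intro ell2_eqI) (auto simp: Rep proj_coproj split: nat.split)
  then show "\<forall>x. cinner (hotel R x) y = 0"
    by (simp add: cinner_hotel)
qed

end

text \<open>
  The unitary operator \<open>U\<close> splits the space of \<open>S\<close> into the summand \<open>M\<close>, which is the space of \<open>Q0\<close>,
  and the summand \<open>L\<close> of sequences over it; \<open>a\<close> is the coordinate in \<open>M\<close>.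
\<close>

locale hotel_extension =
  fixes J0 :: "'h::chilbert_space \<Rightarrow> 'm::chilbert_space" and T Q0
    and U :: "'m \<times> 'm ell2 \<Rightarrow> 'k::chilbert_space"
  assumes lift0: "lifting J0 UNIV Q0 T"
    and quasi0: "quasi_isometry UNIV Q0"
    and U: "unitary_op U"
begin

definition R where "R = closure (range Q0)"
abbreviation e where "e a \<equiv> a - proj R a"
definition a where "a x = fst (inv U x)"
definition J where "J h = U (J0 h, 0)"
definition S where "S x = U (Q0 (a x), hotel R (snd (inv U x)) + econs (e (a x)) 0)"
definition G where "G x = U (0, econs (e (a x)) 0)"
definition Q where "Q x = U (Q0 (a x), 0)"
definition L where "L = range (\<lambda>y. U (0, y))"
definition M where "M = range (\<lambda>m. U (m, 0))"

lemma J0: "isometry_op UNIV UNIV J0" and Q0: "bounded_op UNIV UNIV Q0"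
  and T_Q0: "proj_onto J0 (Q0 m) = T (proj_onto J0 m)"
  using lift0 by (auto simp: lifting_def)

lemma R: "closed_subspace R"
  unfolding R_def by (rule closed_subspace_closure_range[OF Q0])

lemma e_eq_0_iff: "e m = 0 \<longleftrightarrow> m \<in> R"
  using proj_same_iff[OF R, of m] by auto

lemma e_Q0 [simp]: "e (Q0 m) = 0"
  unfolding e_eq_0_iff unfolding R_def by (rule subsetD[OF closure_subset]) (rule rangeI)

lemma norm_Q0_R:
  assumes "m \<in> R"
  shows "norm (Q0 m) = norm m"
proof -
  have "continuous_on UNIV Q0"
    using Q0 by (simp add: bounded_op_UNIV_iff linear_continuous_on)
  then have "closed {m. norm (Q0 m) = norm m}"
    by (intro closed_Collect_eq continuous_intros)
  moreover have "range Q0 \<subseteq> {m. norm (Q0 m) = norm m}"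
    using quasi0 by (auto simp: quasi_isometry_iff)
  ultimately have "R \<subseteq> {m. norm (Q0 m) = norm m}"
    unfolding R_def by (intro closure_minimal)
  with assms show ?thesis
    by blast
qed

lemma U_iso: "isometry_op UNIV UNIV U"
  using U by (simp add: unitary_op_def)

lemma invU [simp]: "inv U (U p) = p"
  by (rule unitary_op_inv[OF U])

lemma inv_U_op: "bounded_op UNIV UNIV (inv U)"
  using unitary_op_inv(1)[OF U] by (simp add: unitary_op_def isometry_op_def)

lemma U_cases: obtains m y where "x = U (m, y)"
proof -
  have "x = U (fst (inv U x), snd (inv U x))"
    by (simp add: unitary_op_inv(2)[OF U])
  then show thesis
    by (rule that)
qed

lemma a_U [simp]: "a (U (m, y)) = m"
  by (simp add: a_def)

lemma U_add: "U (m, y) + U (m', y') = U (m + m', y + y')"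
  using bounded_opD(2)[OF isometry_opD(1)[OF U_iso], of "(m, y)" "(m', y')"] by simp

lemma U_diff: "U (m, y) - U (m', y') = U (m - m', y - y')"
  using bounded_op_diff[OF isometry_opD(1)[OF U_iso], of "(m, y)" "(m', y')"] by simp

lemma U_zero: "U (0, 0) = 0"
  using bounded_op_zero[OF isometry_opD(1)[OF U_iso]] by (simp add: zero_prod_def)

lemma U_eq_iff: "U p = U q \<longleftrightarrow> p = q"
  by (rule inj_eq[OF isometry_inj[OF U_iso]])

lemma cinner_U: "cinner (U (m, y)) (U (m', y')) = cinner m m' + cinner y y'"
  using isometry_cinner[OF _ U_iso] by (simp add: cinner_prod_def)

lemma norm_U_sq: "(norm (U (m, y)))\<^sup>2 = (norm m)\<^sup>2 + (norm y)\<^sup>2"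
  by (simp add: isometry_opD(2)[OF U_iso] norm_Pair)

lemma bounded_op_a: "bounded_op UNIV UNIV a"
  unfolding a_def[abs_def] by (intro bounded_op_comp[OF bounded_op_fst] inv_U_op)

lemma isometry_L: "isometry_op UNIV UNIV (\<lambda>y. U (0, y))"
  unfolding isometry_op_def
  by (simp add: isometry_opD(2)[OF U_iso] norm_Pair bounded_op_comp[OF isometry_opD(1)[OF U_iso]]
      bounded_op_Pair bounded_op_zero_fun)

lemma isometry_M: "isometry_op UNIV UNIV (\<lambda>m. U (m, 0))"
  unfolding isometry_op_def
  by (simp add: isometry_opD(2)[OF U_iso] norm_Pair bounded_op_comp[OF isometry_opD(1)[OF U_iso]]
      bounded_op_Pair bounded_op_zero_fun)

lemma J: "isometry_op UNIV UNIV J"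
  unfolding J_def[abs_def] isometry_op_def
  using isometry_opD[OF J0] isometry_opD[OF isometry_M]
  by (simp add: bounded_op_comp[OF isometry_opD(1)[OF isometry_M]])

lemma S_U: "S (U (m, y)) = U (Q0 m, hotel R y + econs (e m) 0)"
  by (simp add: S_def)

lemma bounded_op_S: "bounded_op UNIV UNIV S"
  unfolding S_def[abs_def]
  by (intro bounded_op_comp[OF isometry_opD(1)[OF U_iso]] bounded_op_Pair bounded_op_add
      bounded_op_econs bounded_op_zero_fun bounded_op_comp[OF Q0] bounded_op_comp[OF bounded_op_hotel[OF R]]
      bounded_op_comp[OF bounded_op_coproj[OF R]] bounded_op_comp[OF bounded_op_snd] bounded_op_a inv_U_op)

lemma bounded_op_G: "bounded_op UNIV UNIV G"
  unfolding G_def[abs_def]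
  by (intro bounded_op_comp[OF isometry_opD(1)[OF isometry_L]]
      bounded_op_econs bounded_op_zero_fun bounded_op_comp[OF bounded_op_coproj[OF R]] bounded_op_a)

lemma bounded_op_Q: "bounded_op UNIV UNIV Q"
  unfolding Q_def[abs_def]
  by (intro bounded_op_comp[OF isometry_opD(1)[OF isometry_M]] bounded_op_comp[OF Q0] bounded_op_a)

lemma norm_S_sq: "(norm (S (U (m, y))))\<^sup>2 = (norm (Q0 m))\<^sup>2 + (norm y)\<^sup>2 + (norm (e m))\<^sup>2"
proof -
  have "cinner (hotel R y) (econs (e m) 0) = 0"
    using orth_range_hotel_iff[OF R, of "econs (e m) 0"] by blast
  then have "(norm (hotel R y + econs (e m) 0))\<^sup>2 = (norm y)\<^sup>2 + (norm (e m))\<^sup>2"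
    by (simp add: norm_add_sq_orth norm_hotel[OF R] norm_econs)
  then show ?thesis
    by (simp add: S_U norm_U_sq)
qed

text \<open>After one step the coordinate in \<open>M\<close> lies in the range of \<open>Q0\<close>, where \<open>Q0\<close> is isometric and \<open>G\<close> vanishes.\<close>

lemma norm_S_S: "norm (S (S x)) = norm (S x)"
proof -
  obtain m y where x: "x = U (m, y)"
    by (rule U_cases)
  define z where "z = hotel R y + econs (e m) 0"
  have Sx: "S x = U (Q0 m, z)"
    by (simp add: x z_def S_U)
  have "(norm (S (S x)))\<^sup>2 = (norm (Q0 (Q0 m)))\<^sup>2 + (norm z)\<^sup>2"
    unfolding Sx norm_S_sq by simp
  also have "\<dots> = (norm (S x))\<^sup>2"
    using quasi0 by (simp add: Sx norm_U_sq quasi_isometry_iff)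
  finally show ?thesis
    by simp
qed

lemma quasi_isometry_S: "quasi_isometry UNIV S"
  by (simp add: quasi_isometry_iff bounded_op_S norm_S_S)

text \<open>
  \<open>S\<close> is bounded below because \<open>Q0\<close> is isometric on \<open>R\<close>, while the component of \<open>m\<close> orthogonal to
  \<open>R\<close> is recorded by \<open>G\<close>.
\<close>

lemma similar_S: "similar_to_isometry S"
proof -
  obtain B where B: "B > 0" "\<And>m. norm (Q0 m) \<le> B * norm m"
    using bounded_op_pos_bound[OF Q0] by auto
  have "norm x \<le> (B + 3) * norm (S x)" for x
  proof -
    obtain m y where x: "x = U (m, y)"
      by (rule U_cases)
    define s where "s = norm (S x)"
    have sq: "s\<^sup>2 = (norm (Q0 m))\<^sup>2 + (norm y)\<^sup>2 + (norm (e m))\<^sup>2"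
      unfolding s_def x by (rule norm_S_sq)
    have "norm (Q0 m) \<le> s"
      by (rule power2_le_imp_le) (use sq in \<open>auto simp: s_def\<close>)
    moreover have "norm y \<le> s"
      by (rule power2_le_imp_le) (use sq in \<open>auto simp: s_def\<close>)
    moreover have em: "norm (e m) \<le> s"
      by (rule power2_le_imp_le) (use sq in \<open>auto simp: s_def\<close>)
    moreover have "B * norm (e m) \<le> B * s"
      using em B(1) by (intro mult_left_mono) auto
    moreover have "norm (proj R m) \<le> norm (Q0 m) + B * norm (e m)"
    proof -
      have "norm (proj R m) = norm (Q0 (proj R m))"
        by (simp add: norm_Q0_R proj_in R)
      also have "Q0 (proj R m) = Q0 m - Q0 (e m)"
        using bounded_op_diff[OF Q0, of m "e m"] by simp
      finally show ?thesis
        using norm_triangle_ineq4[of "Q0 m" "Q0 (e m)"] B(2)[of "e m"] by linarith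
    qed
    moreover have "norm m \<le> norm (proj R m) + norm (e m)"
      using norm_triangle_ineq[of "proj R m" "e m"] by simp
    moreover have "norm x \<le> norm m + norm y"
      by (simp add: x isometry_opD(2)[OF U_iso] norm_Pair sqrt_sum_squares_le_sum)
    ultimately show ?thesis
      unfolding s_def[symmetric] by (simp add: algebra_simps)
  qed
  then show ?thesis
    by (rule similar_to_isometry_if_bounded_below[OF bounded_op_S norm_S_S]) (use B in simp)
qed

lemma proj_J: "proj_onto J (U (m, y)) = proj_onto J0 m"
  by (rule proj_onto_eqI[OF J]) (simp add: J_def U_diff cinner_U proj_onto_orth[OF J0])

lemma lifting_S: "lifting J UNIV S T"
proof -
  have "proj_onto J (S x) = T (proj_onto J x)" for x
    by (cases x rule: U_cases) (simp add: S_U proj_J T_Q0)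
  then show ?thesis
    by (simp add: lifting_def J bounded_op_S)
qed

lemma orth_LM: "orth_decomp L M"
proof -
  have "\<exists>l\<in>L. \<exists>m\<in>M. x = l + m" for x
  proof (cases x rule: U_cases)
    case (1 m y)
    then have "x = U (0, y) + U (m, 0)"
      by (simp add: U_add)
    then show ?thesis
      unfolding L_def M_def by blast
  qed
  moreover have "closed_subspace L" "closed_subspace M"
    unfolding L_def M_def using isometry_closed_range isometry_L isometry_M by blast+
  moreover have "\<forall>l\<in>L. \<forall>m\<in>M. cinner l m = 0"
    by (auto simp: L_def M_def cinner_U)
  ultimately show ?thesis
    by (simp add: orth_decomp_def)
qed

lemma L_subset: "L \<subseteq> ominus_H J"
  by (auto simp: L_def ominus_H_def J_def cinner_U)

lemma Q0_zero: "Q0 0 = 0" and e_zero: "e 0 = 0"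
  using bounded_op_zero[OF Q0] closed_subspaceD(1)[OF R] by (simp_all only: closed_subspace_UNIV e_eq_0_iff)

lemma S_L: "S (U (0, y)) = U (0, hotel R y)"
  unfolding S_U e_zero Q0_zero by simp

lemma block: "upper_block L M S S G Q"
proof -
  have "S (l + m) = (S l + G m) + Q m" if lm: "l \<in> L" "m \<in> M" for l m
  proof -
    obtain y m' where "l = U (0, y)" "m = U (m', 0)"
      using lm by (auto simp: L_def M_def)
    then show ?thesis
      by (simp only: U_add S_L G_def Q_def a_U) (simp add: S_U U_add)
  qed
  moreover have "bounded_op L L S"
    by (rule bounded_op_restrict[OF bounded_op_S]) (auto simp: L_def S_L)
  moreover have "bounded_op M L G"
    by (rule bounded_op_restrict[OF bounded_op_G]) (auto simp: L_def G_def)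
  moreover have "bounded_op M M Q"
    by (rule bounded_op_restrict[OF bounded_op_Q]) (auto simp: M_def Q_def)
  ultimately show ?thesis
    by (simp add: upper_block_def)
qed

lemma isometry_S_L: "isometry_op L L S"
proof -
  have "bounded_op L L S"
    using block by (simp add: upper_block_def)
  then show ?thesis
    using isometry_opD(2)[OF isometry_L]
    by (auto simp: isometry_op_def L_def S_L norm_hotel[OF R])
qed

lemma defect_S: "ker L (adj L S) = G ` M"
proof -
  have L: "closed_subspace L" and S: "bounded_op L L S"
    using orth_LM block by (auto simp: orth_decomp_def upper_block_def)
  have "(\<forall>x\<in>L. cinner (S x) z = 0) \<longleftrightarrow> z \<in> G ` M" if z: "z \<in> L" for z
  proof -
    obtain y where y: "z = U (0, y)"
      using z by (auto simp: L_def)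
    have "(\<forall>x\<in>L. cinner (S x) (U (0, y)) = 0) \<longleftrightarrow> (\<forall>x. cinner (hotel R x) y = 0)"
      by (auto simp: L_def S_L cinner_U)
    also have "\<dots> \<longleftrightarrow> (\<exists>m. y = econs (e m) 0)"
      by (rule orth_range_hotel_iff[OF R])
    also have "\<dots> \<longleftrightarrow> U (0, y) \<in> G ` M"
      by (auto simp: M_def G_def image_iff U_eq_iff)
    finally show ?thesis
      unfolding y .
  qed
  moreover have "G ` M \<subseteq> L"
    by (auto simp: G_def L_def)
  ultimately show ?thesis
    unfolding ker_adj[OF L S] by blast
qed

lemma closed_range_G: "closed (G ` M)"
proof -
  have L: "closed_subspace L" and S: "bounded_op L L S"
    using orth_LM block by (auto simp: orth_decomp_def upper_block_def)
  have "closed {y. \<forall>x. x \<in> L \<longrightarrow> cinner (S x) y = 0}"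
    by (intro closed_Collect_all closed_Collect_imp closed_Collect_eq continuous_on_cinner
        continuous_intros open_Collect_const)
  then have "closed (L \<inter> {y. \<forall>x. x \<in> L \<longrightarrow> cinner (S x) y = 0})"
    by (intro closed_Int closed_subspaceD(4)[OF L])
  moreover have "G ` M = L \<inter> {y. \<forall>x. x \<in> L \<longrightarrow> cinner (S x) y = 0}"
    unfolding defect_S[symmetric] ker_adj[OF L S] by auto
  ultimately show ?thesis
    by simp
qed

sublocale block_lifting J T S L M S G Q
  by unfold_locales
    (simp_all add: lifting_S orth_LM block L_subset isometry_S_L defect_S closed_range_G)

lemma closure_range_Q: "closure (Q ` M) = ker M G"
proof -
  have QM: "Q ` M = (\<lambda>m. U (m, 0)) ` range Q0"
    by (auto simp: M_def Q_def image_iff)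
  have "closure (Q ` M) = (\<lambda>m. U (m, 0)) ` R"
  proof
    have "(\<lambda>m. U (m, 0)) ` range Q0 \<subseteq> (\<lambda>m. U (m, 0)) ` R"
      unfolding R_def by (intro image_mono closure_subset)
    then show "closure (Q ` M) \<subseteq> (\<lambda>m. U (m, 0)) ` R"
      unfolding QM by (intro closure_minimal closed_isometry_image isometry_M R)
    show "(\<lambda>m. U (m, 0)) ` R \<subseteq> closure (Q ` M)"
      unfolding QM R_def using isometry_opD(1)[OF isometry_M]
      by (intro closure_bounded_linear_image_subset) (simp add: bounded_op_UNIV_iff)
  qed
  also have "\<dots> = ker M G"
  proof -
    have "econs b 0 = 0 \<longleftrightarrow> b = 0" for b :: 'm
      using norm_econs[of b 0] by auto
    then have "G (U (m, 0)) = 0 \<longleftrightarrow> m \<in> R" for m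
      unfolding e_eq_0_iff[symmetric]
      using U_eq_iff[of "(0, econs (e m) 0)" "(0, 0)"] by (simp add: G_def U_zero)
    then show ?thesis
      by (auto simp: ker_def M_def)
  qed
  finally show ?thesis .
qed

lemma quasi_isometry_Q: "quasi_isometry M Q"
  using closure_subset[of "Q ` M"]
  by (simp add: quasi_isometry_compression_iff[OF quasi_isometry_S] closure_range_Q)

lemma L_nontrivial:
  assumes "m \<noteq> (0 :: 'm)"
  shows "{0} \<noteq> L"
proof -
  have "econs m 0 \<noteq> 0"
    using assms norm_econs[of m 0] by auto
  then have "U (0, econs m 0) \<noteq> 0"
    using U_eq_iff[of "(0, econs m 0)" "(0, 0)"] by (simp add: U_zero)
  then show ?thesis
    by (auto simp: L_def)
qed

end

theorem theorem3p1:
  fixes T :: "'h::chilbert_space \<Rightarrow> 'h"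
  assumes "bounded_op UNIV UNIV T"
    and "similar_to_contraction T"
  shows "(\<exists>(J :: 'h \<Rightarrow> ('h \<times> complex) ell2) S L M V G Q.
            lifting J UNIV S T \<and> quasi_isometry UNIV S \<and> similar_to_isometry S \<and>
            orth_decomp L M \<and> {0} \<noteq> L \<and> L \<subseteq> ominus_H J \<and>
            upper_block L M S V G Q \<and>
            (\<forall>x\<in>L. V x = S x) \<and> isometry_op L L V \<and> ker L (adj L V) = G ` M \<and>
            lifting J M Q T \<and> quasi_isometry M Q \<and>
            closure (Q ` M) = ker M G \<and>
            ker M (adj M Q) \<subseteq> ker UNIV (adj UNIV S))
       \<and> (\<forall>(J :: 'h \<Rightarrow> 'k::chilbert_space) S L M V G Q.
            lifting J UNIV S T \<and> quasi_isometry UNIV S \<and> left_invertible UNIV S \<and>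
            orth_decomp L M \<and> upper_block L M S V G Q \<and>
            S ` L \<subseteq> L \<and> L \<subseteq> ominus_H J \<and>
            (\<forall>x\<in>L. V x = S x) \<and> isometry_op L L V \<and> ker L (adj L V) = closure (G ` M) \<and>
            (\<forall>x\<in>M. Q x = proj M (S x))
            \<longrightarrow>
            lifting J M Q T \<and>
            (quasi_isometry M Q \<longleftrightarrow> Q ` M \<subseteq> ker M G) \<and>
            (adj M G ` L \<subseteq> ker M (adj M Q) \<and> ker M (adj M Q) = ker UNIV (adj UNIV S)
              \<longleftrightarrow>
             S ` (Q ` M) \<subseteq> Q ` M \<and> Q ` M \<subseteq> range S))"
proof (rule conjI)
  obtain J0 :: "'h \<Rightarrow> ('h \<times> complex) ell2 ell2" and Q0
    where lift0: "lifting J0 UNIV Q0 T" and quasi0: "quasi_isometry UNIV Q0"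
    using quasi_isometric_lifting_exists[OF assms(2)] .
  define U :: "('h \<times> complex) ell2 ell2 \<times> ('h \<times> complex) ell2 ell2 ell2 \<Rightarrow> ('h \<times> complex) ell2"
    where "U = flatten \<circ> flatten \<circ> (\<lambda>p. econs (fst p) (snd p))"
  have "unitary_op U"
    unfolding U_def by (intro unitary_op_compose unitary_op_flatten unitary_op_econs)
  then interpret hotel_extension J0 T Q0 U
    using lift0 quasi0 by unfold_locales
  have "(0 :: 'h, 1 :: complex) \<noteq> 0"
    by (simp add: zero_prod_def)
  then have "econs (econs (0 :: 'h, 1 :: complex) 0) 0 \<noteq> 0"
    by (metis Rep_econs Rep_ell2_zero old.nat.simps(4))
  then have "{0} \<noteq> L"
    by (rule L_nontrivial)
  then show "\<exists>(J :: 'h \<Rightarrow> ('h \<times> complex) ell2) S L M V G Q.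
            lifting J UNIV S T \<and> quasi_isometry UNIV S \<and> similar_to_isometry S \<and>
            orth_decomp L M \<and> {0} \<noteq> L \<and> L \<subseteq> ominus_H J \<and>
            upper_block L M S V G Q \<and>
            (\<forall>x\<in>L. V x = S x) \<and> isometry_op L L V \<and> ker L (adj L V) = G ` M \<and>
            lifting J M Q T \<and> quasi_isometry M Q \<and>
            closure (Q ` M) = ker M G \<and>
            ker M (adj M Q) \<subseteq> ker UNIV (adj UNIV S)"
    using lifting_S quasi_isometry_S similar_S orth_LM L_subset block isometry_S_L defect_S
      lifting_compression quasi_isometry_Q closure_range_Q ker_adj_compression_subset
    by (intro exI[of _ J] exI[of _ S] exI[of _ L] exI[of _ M] exI[of _ G] exI[of _ Q]) simp
next
  show "\<forall>(J :: 'h \<Rightarrow> 'k) S L M V G Q.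
            lifting J UNIV S T \<and> quasi_isometry UNIV S \<and> left_invertible UNIV S \<and>
            orth_decomp L M \<and> upper_block L M S V G Q \<and>
            S ` L \<subseteq> L \<and> L \<subseteq> ominus_H J \<and>
            (\<forall>x\<in>L. V x = S x) \<and> isometry_op L L V \<and> ker L (adj L V) = closure (G ` M) \<and>
            (\<forall>x\<in>M. Q x = proj M (S x))
            \<longrightarrow>
            lifting J M Q T \<and>
            (quasi_isometry M Q \<longleftrightarrow> Q ` M \<subseteq> ker M G) \<and>
            (adj M G ` L \<subseteq> ker M (adj M Q) \<and> ker M (adj M Q) = ker UNIV (adj UNIV S)
              \<longleftrightarrow>
             S ` (Q ` M) \<subseteq> Q ` M \<and> Q ` M \<subseteq> range S)"
  proof (intro allI impI, elim conjE)
    fix J :: "'h \<Rightarrow> 'k" and S L M V G Q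
    assume quasi: "quasi_isometry UNIV S" and left: "left_invertible UNIV S"
      and "lifting J UNIV S T" "orth_decomp L M" "upper_block L M S V G Q" "L \<subseteq> ominus_H J"
        "isometry_op L L V" "ker L (adj L V) = closure (G ` M)"
    then interpret block_lifting J T S L M V G Q
      by unfold_locales
    show "lifting J M Q T \<and>
            (quasi_isometry M Q \<longleftrightarrow> Q ` M \<subseteq> ker M G) \<and>
            (adj M G ` L \<subseteq> ker M (adj M Q) \<and> ker M (adj M Q) = ker UNIV (adj UNIV S)
              \<longleftrightarrow>
             S ` (Q ` M) \<subseteq> Q ` M \<and> Q ` M \<subseteq> range S)"
      using lifting_compression quasi_isometry_compression_iff[OF quasi] ker_adj_conditions_iff[OF left]
      by blast
  qed
qed

end
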